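(* For every $C>0$ there exists a Riemannian metric $g$ on the (oriented) sphere $S^2$ which is convex (its Gaussian curvature $K$ satisfies $K\ge 0$), whose total area is $4\pi$, and such that $m(g,\mu)>C$, where $\mu$ is the Riemannian area form of $g$ and $$m(g,\mu):=\inf\Big\{\ \sup_{x\in S^2}|\beta_x|\ \Big|\ \beta\in\Omega^1(S^2),\ d\beta=(1-K)\mu\ \Big\}.$$
   Context: $|\beta_x|$ denotes the norm of the covector $\beta_x\in T_x^*S^2$ dual to $g_x$. Since the area is $4\pi$, Gauss–Bonnet implies that $(1-K)\mu$ is exact, so the infimum is over a nonempty set. *)

theory Defs
  imports "HOL-Analysis.Analysis"
begin

definition partial_deriv :: "2 \<Rightarrow> (real^2 \<Rightarrow> 'b::real_normed_vector) \<Rightarrow> real^2 \<Rightarrow> 'b" where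
  "partial_deriv i f y = frechet_derivative f (at y) (axis i 1)"

primrec times_differentiable :: "nat \<Rightarrow> (real^2 \<Rightarrow> real) \<Rightarrow> bool" where
  "times_differentiable 0 f \<longleftrightarrow> continuous_on UNIV f"
| "times_differentiable (Suc k) f \<longleftrightarrow> (\<forall>y. f differentiable (at y)) \<and>
     (\<forall>v. times_differentiable k (\<lambda>y. frechet_derivative f (at y) v))"

definition smooth :: "(real^2 \<Rightarrow> real) \<Rightarrow> bool" where
  "smooth f \<longleftrightarrow> (\<forall>k. times_differentiable k f)"

definition S2 :: "(real^3) set" where
  "S2 = sphere 0 1"

definition tangent_space :: "real^3 \<Rightarrow> (real^3) set" where
  "tangent_space x = {v. x \<bullet> v = 0}"

text \<open>Inverses of the stereographic projections from the north pole (0,0,1) and from the south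
  pole. The sphere carries the boundary orientation of the unit ball, so that a frame (v, w) of
  the tangent plane at x is positive iff the determinant of (x, v, w) is positive; the sign in
  the second coordinate of \<open>stereo_N\<close> makes both parametrizations orientation preserving.\<close>

definition stereo_N :: "real^2 \<Rightarrow> real^3" where
  "stereo_N y = (1 / (1 + (norm y)\<^sup>2)) *\<^sub>R vector [2 * y$1, - 2 * y$2, (norm y)\<^sup>2 - 1]"

definition stereo_S :: "real^2 \<Rightarrow> real^3" where
  "stereo_S y = (1 / (1 + (norm y)\<^sup>2)) *\<^sub>R vector [2 * y$1, 2 * y$2, 1 - (norm y)\<^sup>2]"

definition atlas :: "(real^2 \<Rightarrow> real^3) set" where
  "atlas = {stereo_N, stereo_S}"

definition chart_at :: "real^3 \<Rightarrow> real^2 \<Rightarrow> real^3" where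
  "chart_at x = (if x = vector [0, 0, 1] then stereo_S else stereo_N)"

text \<open>Tensors on the sphere are represented by functions of a point and of vectors of the ambient
  space. Only their values at points of the sphere on tangent vectors are ever used: a covector
  (a bilinear form) on a tangent plane is represented by any linear (bilinear) extension of it to
  the ambient space, and every covector has such an extension.\<close>

type_synonym form1 = "real^3 \<Rightarrow> real^3 \<Rightarrow> real"
type_synonym form2 = "real^3 \<Rightarrow> real^3 \<Rightarrow> real^3 \<Rightarrow> real"
type_synonym metric = "real^3 \<Rightarrow> real^3 \<Rightarrow> real^3 \<Rightarrow> real"

definition pullback1 :: "(real^2 \<Rightarrow> real^3) \<Rightarrow> form1 \<Rightarrow> 2 \<Rightarrow> real^2 \<Rightarrow> real" where
  "pullback1 \<phi> \<beta> i y = \<beta> (\<phi> y) (partial_deriv i \<phi> y)"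

definition pullback2 :: "(real^2 \<Rightarrow> real^3) \<Rightarrow> form2 \<Rightarrow> 2 \<Rightarrow> 2 \<Rightarrow> real^2 \<Rightarrow> real" where
  "pullback2 \<phi> \<omega> i j y = \<omega> (\<phi> y) (partial_deriv i \<phi> y) (partial_deriv j \<phi> y)"

definition riemannian_metric :: "metric \<Rightarrow> bool" where
  "riemannian_metric g \<longleftrightarrow>
     (\<forall>x\<in>S2. bilinear (g x)) \<and>
     (\<forall>x\<in>S2. \<forall>v\<in>tangent_space x. \<forall>w\<in>tangent_space x. g x v w = g x w v) \<and>
     (\<forall>x\<in>S2. \<forall>v\<in>tangent_space x. v \<noteq> 0 \<longrightarrow> g x v v > 0) \<and>
     (\<forall>\<phi>\<in>atlas. \<forall>i j. smooth (pullback2 \<phi> g i j))"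

definition one_form :: "form1 \<Rightarrow> bool" where
  "one_form \<beta> \<longleftrightarrow>
     (\<forall>x\<in>S2. linear (\<beta> x)) \<and> (\<forall>\<phi>\<in>atlas. \<forall>i. smooth (pullback1 \<phi> \<beta> i))"

text \<open>The equation of 2-forms \<open>d\<beta> = \<omega>\<close>.\<close>

definition has_exterior_deriv :: "form1 \<Rightarrow> form2 \<Rightarrow> bool" where
  "has_exterior_deriv \<beta> \<omega> \<longleftrightarrow>
     (\<forall>\<phi>\<in>atlas. \<forall>y. partial_deriv 1 (pullback1 \<phi> \<beta> 2) y - partial_deriv 2 (pullback1 \<phi> \<beta> 1) y
        = pullback2 \<phi> \<omega> 1 2 y)"

text \<open>The 2-form equal to 1 on positively oriented g-orthonormal frames; \<open>x \<bullet> cross3 v w\<close> is the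
  determinant of (x, v, w).\<close>

definition area_form :: "metric \<Rightarrow> form2" where
  "area_form g x v w = sgn (x \<bullet> cross3 v w) * sqrt (g x v v * g x w w - (g x v w)\<^sup>2)"

text \<open>A single chart suffices for integration, as it covers the sphere up to one point.\<close>

definition form_integral :: "form2 \<Rightarrow> real" where
  "form_integral \<omega> = (LINT y|lborel. pullback2 stereo_N \<omega> 1 2 y)"

definition total_area :: "metric \<Rightarrow> real" where
  "total_area g = form_integral (area_form g)"

definition metric_matrix :: "(real^2 \<Rightarrow> real^3) \<Rightarrow> metric \<Rightarrow> real^2 \<Rightarrow> real^2^2" where
  "metric_matrix \<phi> g y = (\<chi> i j. pullback2 \<phi> g i j y)"

text \<open>\<open>christoffel h l i j\<close> has upper index \<open>l\<close>, and \<open>riemann h l k i j\<close> is the coefficient of the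
  \<open>l\<close>-th coordinate field in \<open>R(\<partial>\<^sub>i, \<partial>\<^sub>j)\<partial>\<^sub>k\<close>, where
  \<open>R(X, Y)Z = \<nabla>\<^sub>X \<nabla>\<^sub>Y Z - \<nabla>\<^sub>Y \<nabla>\<^sub>X Z - \<nabla>\<^bsub>[X,Y]\<^esub> Z\<close>.
  The Gaussian curvature is \<open>g(R(\<partial>\<^sub>1, \<partial>\<^sub>2)\<partial>\<^sub>2, \<partial>\<^sub>1) / det g\<close>.\<close>

definition christoffel :: "(real^2 \<Rightarrow> real^2^2) \<Rightarrow> 2 \<Rightarrow> 2 \<Rightarrow> 2 \<Rightarrow> real^2 \<Rightarrow> real" where
  "christoffel h l i j y = (1/2) * (\<Sum>m\<in>UNIV. matrix_inv (h y) $ l $ m *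
     (partial_deriv i (\<lambda>z. h z $ j $ m) y + partial_deriv j (\<lambda>z. h z $ i $ m) y
        - partial_deriv m (\<lambda>z. h z $ i $ j) y))"

definition riemann :: "(real^2 \<Rightarrow> real^2^2) \<Rightarrow> 2 \<Rightarrow> 2 \<Rightarrow> 2 \<Rightarrow> 2 \<Rightarrow> real^2 \<Rightarrow> real" where
  "riemann h l k i j y =
     partial_deriv i (christoffel h l j k) y - partial_deriv j (christoffel h l i k) y
     + (\<Sum>m\<in>UNIV. christoffel h l i m y * christoffel h m j k y
          - christoffel h l j m y * christoffel h m i k y)"

definition local_gauss_curvature :: "(real^2 \<Rightarrow> real^2^2) \<Rightarrow> real^2 \<Rightarrow> real" where
  "local_gauss_curvature h y = (\<Sum>l\<in>UNIV. h y $ l $ 1 * riemann h l 2 1 2 y) / det (h y)"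

definition gauss_curvature :: "metric \<Rightarrow> real^3 \<Rightarrow> real" where
  "gauss_curvature g x =
     local_gauss_curvature (metric_matrix (chart_at x) g) (inv (chart_at x) x)"

definition covector_norm :: "metric \<Rightarrow> real^3 \<Rightarrow> (real^3 \<Rightarrow> real) \<Rightarrow> real" where
  "covector_norm g x \<alpha> = (SUP v\<in>{v \<in> tangent_space x. g x v v \<le> 1}. \<bar>\<alpha> v\<bar>)"

text \<open>Real infimum and suprema: the value is meaningful because the set of primitives is nonempty
  by Gauss-Bonnet (for total area \<open>4\<pi>\<close>) and the norms are bounded on the compact sphere. No
  convention that the infimum of the empty set is infinite is involved.\<close>

definition min_primitive_norm :: "metric \<Rightarrow> form2 \<Rightarrow> real" where
  "min_primitive_norm g \<mu> = (INF \<beta>\<in>{\<beta>. one_form \<beta> \<and>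
       has_exterior_deriv \<beta> (\<lambda>x v w. (1 - gauss_curvature g x) * \<mu> x v w)}.
     SUP x\<in>S2. covector_norm g x (\<beta> x))"

end

theory Submission
  imports Defs
begin

text \<open>
  The metrics are teardrops: spheres of revolution that look like a cone of total curvature \<open>\<pi>\<close>
  whose tip at the south pole is rounded at scale \<open>\<delta>\<close>. They are conformal to the round metric, with
  factor \<open>(1 + \<delta>) / (2 \<surd>w)\<close> for an affine function \<open>w\<close> of the height which increases from
  \<open>\<delta>\<^sup>2\<close> to 1; this choice makes the area equal to \<open>4 \<pi>\<close>, the curvature positive, and an explicit
  rotationally symmetric primitive of \<open>(1 - K) \<mu>\<close> algebraic in \<open>w\<close>. A small disc around the tip
  has area close to 0 and total curvature bounded below, so the integral of \<open>(1 - K) \<mu>\<close> over it is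
  bounded away from 0, while its boundary has length of order \<open>\<surd>\<delta>\<close>. By Stokes, every primitive
  therefore has norm at least of order \<open>1 / \<surd>\<delta>\<close> somewhere on that circle.
\<close>

section \<open>Smooth functions on the plane\<close>

lemma partial_deriv_eq:
  "(f has_derivative f') (at y) \<Longrightarrow> partial_deriv i f y = f' (axis i 1)"
  by (simp add: partial_deriv_def frechet_derivative_at[symmetric])

lemma times_differentiable_continuous:
  "times_differentiable k f \<Longrightarrow> continuous_on UNIV f"
  by (cases k) (auto simp: continuous_on_eq_continuous_at intro: differentiable_imp_continuous_within)

text \<open>The product and power rules keep undifferentiated factors next to differentiated ones,
  so their inductions need the factors at the lower order as well.\<close>

lemma times_differentiable_Suc_D:
  "times_differentiable (Suc k) f \<Longrightarrow> times_differentiable k f"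
proof (induction k arbitrary: f)
  case 0
  then show ?case using times_differentiable_continuous by fastforce
next
  case (Suc k)
  then show ?case by (metis times_differentiable.simps(2))
qed

lemma times_differentiable_const: "times_differentiable k (\<lambda>y. c)"
  by (induction k arbitrary: c) simp_all

lemma times_differentiable_nth: "times_differentiable k (\<lambda>y. y $ i)"
proof (cases k)
  case (Suc n)
  have "((\<lambda>y. y $ i) has_derivative (\<lambda>v. v $ i)) (at y)" for y :: "real^2"
    by (intro bounded_linear_imp_has_derivative bounded_linear_vec_nth)
  then have "frechet_derivative (\<lambda>y. y $ i) (at y) = (\<lambda>v. v $ i)" for y :: "real^2"
    by (metis frechet_derivative_at)
  moreover have "(\<lambda>y. y $ i) differentiable (at y)" for y :: "real^2"
    by (rule differentiableI[OF bounded_linear_imp_has_derivative[OF bounded_linear_vec_nth]])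
  ultimately show ?thesis by (simp add: Suc times_differentiable_const)
qed (simp add: continuous_intros)

lemma times_differentiable_add:
  "times_differentiable k f \<Longrightarrow> times_differentiable k g \<Longrightarrow> times_differentiable k (\<lambda>y. f y + g y)"
proof (induction k arbitrary: f g)
  case 0
  then show ?case by (simp add: continuous_on_add)
next
  case (Suc k)
  have df: "\<And>y. f differentiable (at y)" and dg: "\<And>y. g differentiable (at y)"
    using Suc.prems by simp_all
  have "frechet_derivative (\<lambda>y. f y + g y) (at y) v
      = frechet_derivative f (at y) v + frechet_derivative g (at y) v" for y v
    using fun_cong[OF frechet_derivative_at[OF has_derivative_add[OF
      df[of y, unfolded frechet_derivative_works] dg[of y, unfolded frechet_derivative_works]]]] by simp
  then show ?case using Suc df dg by simp
qed

lemma times_differentiable_mult: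
  "times_differentiable k f \<Longrightarrow> times_differentiable k g \<Longrightarrow> times_differentiable k (\<lambda>y. f y * g y)"
proof (induction k arbitrary: f g)
  case 0
  then show ?case by (simp add: continuous_on_mult)
next
  case (Suc k)
  have df: "\<And>y. f differentiable (at y)" and dg: "\<And>y. g differentiable (at y)"
    using Suc.prems by simp_all
  have eq: "frechet_derivative (\<lambda>y. f y * g y) (at y) v
      = f y * frechet_derivative g (at y) v + frechet_derivative f (at y) v * g y" for y v
    using fun_cong[OF frechet_derivative_at[OF has_derivative_mult[OF
      df[of y, unfolded frechet_derivative_works] dg[of y, unfolded frechet_derivative_works]]]] by simp
  have "times_differentiable k f" "times_differentiable k g"
    using Suc.prems times_differentiable_Suc_D by blast+
  then show ?case using Suc df dg by (simp add: eq times_differentiable_add)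
qed

text \<open>Differentiation lowers the exponent, so the induction runs over all \<open>p\<close> at
  once. Real powers of positive functions give both reciprocals and square roots, which is all that
  is required beyond polynomials.\<close>

lemma times_differentiable_powr:
  assumes "\<And>y. f y > 0"
  shows "times_differentiable k f \<Longrightarrow> times_differentiable k (\<lambda>y. f y powr p)"
proof (induction k arbitrary: p)
  case 0
  then show ?case using assms by (auto intro!: continuous_on_powr simp: less_imp_neq[symmetric])
next
  case (Suc k)
  have df: "\<And>y. f differentiable (at y)" using Suc.prems by simp
  have D: "((\<lambda>y. f y powr p) has_derivative
      (\<lambda>v. p * (f y powr (p - 1) * frechet_derivative f (at y) v))) (at y)" for y
    using df[of y, unfolded frechet_derivative_works] assms[of y]
    by (auto intro!: derivative_eq_intros simp: powr_diff field_simps)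
  have *: "frechet_derivative (\<lambda>y. f y powr p) (at y) v
      = p * (f y powr (p - 1) * frechet_derivative f (at y) v)" for y v
    using fun_cong[OF frechet_derivative_at[OF D]] by simp
  have "(\<lambda>y. f y powr p) differentiable (at y)" for y
    using D by (rule differentiableI)
  moreover have "times_differentiable k (\<lambda>y. frechet_derivative f (at y) v)" for v
    using Suc.prems by simp
  moreover have "times_differentiable k f"
    using Suc.prems times_differentiable_Suc_D by blast
  ultimately show ?case
    using Suc.IH by (simp add: * times_differentiable_mult times_differentiable_const)
qed

lemma smooth_const [simp]: "smooth (\<lambda>y. c)"
  and smooth_nth [simp]: "smooth (\<lambda>y. y $ i)"
  and smooth_add: "smooth f \<Longrightarrow> smooth g \<Longrightarrow> smooth (\<lambda>y. f y + g y)"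
  and smooth_mult: "smooth f \<Longrightarrow> smooth g \<Longrightarrow> smooth (\<lambda>y. f y * g y)"
  and smooth_powr: "smooth f \<Longrightarrow> (\<And>y. f y > 0) \<Longrightarrow> smooth (\<lambda>y. f y powr p)"
  by (simp_all add: smooth_def times_differentiable_const times_differentiable_nth
      times_differentiable_add times_differentiable_mult times_differentiable_powr)

lemma smooth_diff: "smooth f \<Longrightarrow> smooth g \<Longrightarrow> smooth (\<lambda>y. f y - g y)"
  using smooth_add[OF _ smooth_mult[OF smooth_const[of "-1"]]] by simp

lemma smooth_divide:
  assumes "smooth f" "smooth g" "\<And>y. g y > 0"
  shows "smooth (\<lambda>y. f y / g y)"
proof -
  have "(\<lambda>y. f y / g y) = (\<lambda>y. f y * g y powr (-1))"
    using assms(3) by (simp add: fun_eq_iff powr_minus_divide abs_of_pos)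
  then show ?thesis using smooth_mult[OF assms(1) smooth_powr[OF assms(2,3)], of "-1"] by (simp only:)
qed

lemma smooth_sqrt:
  assumes "smooth f" "\<And>y. f y > 0"
  shows "smooth (\<lambda>y. sqrt (f y))"
  using smooth_powr[OF assms, of "1/2"] assms(2) by (simp add: powr_half_sqrt less_imp_le)

lemma smooth_norm_sq: "smooth (\<lambda>y. (norm y)\<^sup>2)"
  by (simp add: power2_norm_eq_inner inner_vec_def sum_2 smooth_add smooth_mult)

lemma smooth_differentiable: "smooth f \<Longrightarrow> f differentiable (at y)"
  by (metis smooth_def times_differentiable.simps(2))

lemma smooth_continuous: "smooth f \<Longrightarrow> continuous_on S f"
  by (metis smooth_def times_differentiable_continuous continuous_on_subset subset_UNIV)

lemma smooth_partial_deriv: "smooth f \<Longrightarrow> smooth (partial_deriv i f)"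
  unfolding smooth_def partial_deriv_def by (metis times_differentiable.simps(2))

lemma smooth_has_derivative:
  assumes "smooth f"
  shows "(f has_derivative (\<lambda>v. partial_deriv 1 f y * v $ 1 + partial_deriv 2 f y * v $ 2)) (at y)"
proof -
  let ?D = "frechet_derivative f (at y)"
  have *: "(f has_derivative ?D) (at y)"
    using smooth_differentiable[OF assms] by (simp add: frechet_derivative_works)
  have "?D v = partial_deriv 1 f y * v $ 1 + partial_deriv 2 f y * v $ 2" for v
  proof -
    have "v = v $ 1 *\<^sub>R axis 1 1 + v $ 2 *\<^sub>R axis 2 1"
      by (simp add: vec_eq_iff forall_2 axis_def)
    then have "?D v = ?D (v $ 1 *\<^sub>R axis 1 1 + v $ 2 *\<^sub>R axis 2 1)" by simp
    also have "\<dots> = v $ 1 * ?D (axis 1 1) + v $ 2 * ?D (axis 2 1)"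
      using linear_frechet_derivative[OF smooth_differentiable[OF assms]]
      by (simp only: linear_add linear_scale real_scaleR_def)
    finally show ?thesis by (simp add: partial_deriv_def mult.commute)
  qed
  then have "?D = (\<lambda>v. partial_deriv 1 f y * v $ 1 + partial_deriv 2 f y * v $ 2)" by blast
  with * show ?thesis by simp
qed

lemma smooth_partial_deriv_diff:
  assumes "smooth f" "smooth g"
  shows "partial_deriv i (\<lambda>y. f y - g y) y = partial_deriv i f y - partial_deriv i g y"
  using partial_deriv_eq[OF has_derivative_diff[OF
      assms[THEN smooth_differentiable, unfolded frechet_derivative_works]]]
  by (simp add: partial_deriv_def)

section \<open>Integration in the plane\<close>

text \<open>Stokes on a disc, obtained by varying the radius. For a closed form
  \<open>P dx + Q dy\<close> the \<open>r\<close>-derivative of its angular part \<open>w\<close> is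
  the \<open>t\<close>-derivative of its radial part \<open>a\<close>, which is periodic. The
  integral is therefore constant in \<open>r\<close>, and it vanishes at
  \<open>r = 0\<close>.\<close>

lemma closed_form_circle_integral:
  fixes P Q :: "real^2 \<Rightarrow> real"
  assumes sP: "smooth P" and sQ: "smooth Q"
    and closed: "\<And>y. partial_deriv 1 Q y = partial_deriv 2 P y"
  shows "integral {0..2*pi} (\<lambda>t. r * (Q (vector [r * cos t, r * sin t]) * cos t
           - P (vector [r * cos t, r * sin t]) * sin t)) = 0"
proof -
  define c where "c r t = (vector [r * cos t, r * sin t] :: real^2)" for r t
  define w where "w r t = r * (Q (c r t) * cos t - P (c r t) * sin t)" for r t
  define a where "a r t = (P (c r t) * cos t + Q (c r t) * sin t)" for r t
  define w' where "w' r t = (Q (c r t) * cos t - P (c r t) * sin t)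
     + r * ((partial_deriv 1 Q (c r t) * cos t + partial_deriv 2 Q (c r t) * sin t) * cos t
     - (partial_deriv 1 P (c r t) * cos t + partial_deriv 2 P (c r t) * sin t) * sin t)" for r t
  have c_alt: "c r t = r *\<^sub>R (cos t *\<^sub>R axis 1 1 + sin t *\<^sub>R axis 2 1)" for r t
    by (simp add: c_def vec_eq_iff forall_2 axis_def)
  have cr: "((\<lambda>r. c r t) has_derivative (\<lambda>h. h *\<^sub>R c 1 t)) (at r within S)" for r t S
    unfolding c_alt by (auto intro!: derivative_eq_intros)
  \<comment> \<open>The velocity of the circle is the position vector turned by a right angle, hence
    the shift by \<open>pi/2\<close>.\<close>
  have ct: "(c r has_derivative (\<lambda>h. h *\<^sub>R c r (t + pi/2))) (at t within S)" for r t S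
    unfolding c_alt by (auto intro!: derivative_eq_intros simp: cos_add sin_add scaleR_add_right algebra_simps)
  have fr: "((\<lambda>r. f (c r t)) has_real_derivative
      (partial_deriv 1 f (c r t) * cos t + partial_deriv 2 f (c r t) * sin t)) (at r within S)"
    if "smooth f" for f r t S
    using has_derivative_compose[OF cr smooth_has_derivative[OF that]]
    unfolding has_field_derivative_def
    by (rule has_derivative_eq_rhs) (simp add: fun_eq_iff c_def algebra_simps)
  have ft: "((\<lambda>t. f (c r t)) has_real_derivative
      r * (- partial_deriv 1 f (c r t) * sin t + partial_deriv 2 f (c r t) * cos t)) (at t within S)"
    if "smooth f" for f r t S
    using has_derivative_compose[OF ct smooth_has_derivative[OF that]]
    unfolding has_field_derivative_def
    by (rule has_derivative_eq_rhs) (simp add: fun_eq_iff c_def algebra_simps cos_add sin_add)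
  have d1: "((\<lambda>r. w r t) has_real_derivative w' r t) (at r within S)" for r t S
    unfolding w_def w'_def
    by (auto intro!: derivative_eq_intros fr sP sQ simp: algebra_simps)
  \<comment> \<open>The only use of closedness: the two expressions differ by \<open>r\<close> times
    the difference of the mixed partial derivatives.\<close>
  have d2: "(a r has_real_derivative w' r t) (at t within S)" for r t S
    unfolding a_def[abs_def] w'_def
    by (auto intro!: derivative_eq_intros ft sP sQ simp: algebra_simps closed)
  have contc: "continuous_on S (\<lambda>x. c (fst x) (snd x))" for S
    unfolding c_alt by (intro continuous_intros)
  have cc: "continuous_on S (\<lambda>x. f (c (fst x) (snd x)))" if "smooth f" for f S
    by (rule continuous_on_compose2[OF smooth_continuous[OF that, of UNIV] contc]) simp
  have cw': "continuous_on S (\<lambda>(r, t). w' r t)" for S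
    unfolding w'_def case_prod_beta
    by (intro continuous_intros cc sP sQ smooth_partial_deriv)
  have "continuous_on S (\<lambda>t. w r t)" for r S
  proof -
    have "continuous_on S (\<lambda>t. f (c r t))" if "smooth f" for f
      using ft[OF that] by (meson DERIV_continuous continuous_on_eq_continuous_within)
    then show ?thesis unfolding w_def using sP sQ by (intro continuous_intros) auto
  qed
  then have int: "w r integrable_on cbox 0 (2*pi)" for r
    by (simp add: integrable_continuous_real)
  \<comment> \<open>Differentiation under the integral sign; it is justified by joint continuity of
    \<open>w'\<close>.\<close>
  have "((\<lambda>r. integral (cbox 0 (2*pi)) (w r)) has_real_derivative
     integral (cbox 0 (2*pi)) (w' r)) (at r within UNIV)" for r
    by (rule leibniz_rule_field_derivative[OF d1 int cw']) auto
  moreover have "integral (cbox 0 (2*pi)) (w' r) = 0" for r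
  proof -
    have "(w' r has_integral a r (2*pi) - a r 0) {0..2*pi}"
      by (rule fundamental_theorem_of_calculus)
         (auto simp: has_real_derivative_iff_has_vector_derivative[symmetric] d2)
    then show ?thesis by (simp add: a_def c_def integral_unique)
  qed
  ultimately have "(\<lambda>r. integral (cbox 0 (2*pi)) (w r)) r = (\<lambda>r. integral (cbox 0 (2*pi)) (w r)) 0"
    by (intro DERIV_isconst_all) simp
  also have "\<dots> = 0" by (simp add: w_def[abs_def])
  finally show ?thesis by (simp add: w_def[abs_def] c_def)
qed

text \<open>The disc \<open>|y|^2 \<le> a\<close> has area \<open>pi a\<close>, so the squared norm
  has constant density \<open>pi\<close> on the half line. Half lines \<open>{..a}\<close> generate
  the Borel sets and are stable under intersection, so comparing the measures on them
  suffices.\<close>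

lemma distr_norm_sq:
  "distr lborel borel (\<lambda>y::real^2. (norm y)\<^sup>2)
     = density lborel (\<lambda>s. ennreal pi * indicator {0..} s)" (is "?M = ?N")
proof (rule measure_eqI_generator_eq)
  let ?E = "range (\<lambda>a::real. {..a})"
  show "Int_stable ?E"
    by (auto simp: Int_stable_def)
  show "sets ?M = sigma_sets UNIV ?E" "sets ?N = sigma_sets UNIV ?E"
    by (simp_all add: borel_eq_atMost)
  have M: "emeasure ?M {..a} = ennreal (pi * max 0 a)" for a
  proof (cases "a \<ge> 0")
    case True
    have "(\<lambda>y::real^2. (norm y)\<^sup>2) -` {..a} = cball 0 (sqrt a)"
      using True by (auto simp: real_le_rsqrt) (metis norm_ge_zero real_sqrt_le_iff real_sqrt_unique)
    then show ?thesis
      using True by (simp add: emeasure_distr emeasure_cball unit_ball_vol_2)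
  next
    case False
    then have "(\<lambda>y::real^2. (norm y)\<^sup>2) -` {..a} = {}"
      by (auto simp: not_le) (meson not_less order_trans zero_le_power2)
    then show ?thesis
      using False by (simp add: emeasure_distr)
  qed
  have N: "emeasure ?N {..a} = ennreal (pi * max 0 a)" for a
  proof -
    have "emeasure ?N {..a} = (\<integral>\<^sup>+s. ennreal pi * indicator {0..a} s \<partial>lborel)"
      by (subst emeasure_density)
         (auto intro!: nn_integral_cong simp: indicator_def)
    also have "\<dots> = ennreal (pi * max 0 a)"
      by (cases "a \<ge> 0") (simp_all add: nn_integral_cmult ennreal_mult')
    finally show ?thesis .
  qed
  show "\<And>X. X \<in> ?E \<Longrightarrow> emeasure ?M X = emeasure ?N X"
    using M N by auto
  show "range (\<lambda>n. {..real n}) \<subseteq> ?E" by auto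
  show "(\<Union>n. {..real n}) = UNIV"
    by (auto simp: real_arch_simple)
  show "emeasure ?M {..real n} \<noteq> \<infinity>" for n
    by (simp add: M)
qed auto

text \<open>In the variable \<open>s = |y|^2\<close> polar integration becomes \<open>pi\<close>
  times an integral over the half line, to which the fundamental theorem applies. Passing through
  the nonnegative integral settles integrability at the same time.\<close>

lemma radial_integral:
  fixes f F :: "real \<Rightarrow> real"
  assumes [measurable]: "f \<in> borel_measurable borel"
    and F: "\<And>s. s \<ge> 0 \<Longrightarrow> (F has_real_derivative f s) (at s)"
    and pos: "\<And>s. s \<ge> 0 \<Longrightarrow> 0 \<le> f s"
    and lim: "(F \<longlongrightarrow> T) at_top"
  shows "(LINT y|lborel. f ((norm (y::real^2))\<^sup>2)) = pi * (T - F 0)"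
proof -
  have T: "F 0 \<le> T"
  proof (rule tendsto_lowerbound[OF lim])
    show "\<forall>\<^sub>F x in at_top. F 0 \<le> F x"
      using eventually_ge_at_top[of 0]
      by eventually_elim (auto intro!: DERIV_nonneg_imp_nondecreasing[of 0 _ F] F pos)
  qed simp
  have "(\<integral>\<^sup>+y. f ((norm (y::real^2))\<^sup>2) \<partial>lborel)
      = (\<integral>\<^sup>+s. f s \<partial>distr lborel borel (\<lambda>y::real^2. (norm y)\<^sup>2))"
    by (subst nn_integral_distr) auto
  also have "\<dots> = (\<integral>\<^sup>+s. ennreal pi * (ennreal (f s) * indicator {0..} s) \<partial>lborel)"
    unfolding distr_norm_sq by (subst nn_integral_density) (auto simp: ac_simps)
  also have "\<dots> = ennreal pi * ennreal (T - F 0)"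
    using nn_integral_FTC_atLeast[OF assms] by (simp add: nn_integral_cmult)
  finally show ?thesis
    using T pos by (subst integral_eq_nn_integral) (auto simp: ennreal_mult'[symmetric])
qed

section \<open>Conformal metrics and stereographic charts\<close>

lemma matrix_inv_mat:
  assumes "c \<noteq> (0::real)"
  shows "matrix_inv (mat c :: real^2^2) = mat (1 / c)"
proof -
  let ?A = "mat c :: real^2^2" and ?B = "mat (1 / c) :: real^2^2"
  have AB: "?A ** ?B = mat 1" and BA: "?B ** ?A = mat 1"
    using assms by (simp_all add: matrix_matrix_mult_def mat_def vec_eq_iff forall_2 sum_2)
  \<comment> \<open>\<open>matrix_inv\<close> is a choice among two-sided inverses, so exhibiting
    one makes the choice an inverse; uniqueness then identifies it.\<close>
  have "?A ** matrix_inv ?A = mat 1 \<and> matrix_inv ?A ** ?A = mat 1"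
    unfolding matrix_inv_def by (rule someI[of _ ?B]) (use AB BA in blast)
  then have inv: "matrix_inv ?A ** ?A = mat 1" ..
  have "matrix_inv ?A = matrix_inv ?A ** (?A ** ?B)"
    by (simp only: AB matrix_mul_rid)
  also have "\<dots> = ?B"
    by (simp only: matrix_mul_assoc inv matrix_mul_lid)
  finally show ?thesis .
qed

text \<open>With \<open>u\<close> half the gradient of the logarithm of the conformal factor this is
  \<open>K = - \<Delta> (log \<rho>) / (2 \<rho>)\<close>.\<close>

lemma local_gauss_curvature_conformal:
  fixes \<rho> :: "real^2 \<Rightarrow> real" and u :: "2 \<Rightarrow> real^2 \<Rightarrow> real"
  assumes pos: "\<And>y. \<rho> y > 0"
    and d\<rho>: "\<And>i y. partial_deriv i \<rho> y = 2 * \<rho> y * u i y"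
    and du: "\<And>i y. u i differentiable (at y)"
  shows "local_gauss_curvature (\<lambda>y. mat (\<rho> y)) y
    = - (partial_deriv 1 (u 1) y + partial_deriv 2 (u 2) y) / \<rho> y"
proof -
  let ?h = "\<lambda>y. mat (\<rho> y) :: real^2^2"
  have entry: "(\<lambda>z. ?h z $ i $ j) = (if i = j then \<rho> else (\<lambda>z. 0))" for i j
    by (simp add: mat_def fun_eq_iff)
  have zero: "partial_deriv i (\<lambda>z. 0::real) y = 0" for i y
    by (subst partial_deriv_eq[OF has_derivative_const]) simp
  have D: "partial_deriv k (\<lambda>z. ?h z $ i $ j) y = (if i = j then 2 * \<rho> y * u k y else 0)" for i j k y
    by (simp add: entry d\<rho> zero)
  have pos': "\<rho> y \<noteq> 0" for y using pos[of y] by simp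
  \<comment> \<open>The conformal factor cancels against the inverse matrix, so the Christoffel
    symbols are linear in the logarithmic gradient \<open>u\<close>.\<close>
  have G: "christoffel ?h l i j y = (if j = l then u i y else 0) + (if i = l then u j y else 0)
      - (if i = j then u l y else 0)" for l i j y
    using pos'[of y] exhaust_2[of l] exhaust_2[of i] exhaust_2[of j] unfolding christoffel_def D matrix_inv_mat[OF pos']
    by (elim disjE) (simp_all add: sum_2 mat_def)
  have minus: "partial_deriv i (\<lambda>y. - u j y) y = - partial_deriv i (u j) y" for i j
    using partial_deriv_eq[OF has_derivative_minus[OF du[of j y, unfolded frechet_derivative_works]]]
    by (simp add: partial_deriv_def)
  have G': "christoffel ?h 1 2 2 = (\<lambda>y. - u 1 y)" "christoffel ?h 1 1 2 = u 2"
      "christoffel ?h 1 1 1 = u 1" "christoffel ?h 1 2 1 = u 2"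
      "christoffel ?h 2 2 2 = u 2" "christoffel ?h 2 1 2 = u 1"
    by (simp_all add: G fun_eq_iff)
  \<comment> \<open>The products of Christoffel symbols cancel and only minus the divergence of
    \<open>u\<close> is left. As the metric is diagonal, this one component determines the
    curvature.\<close>
  have "riemann ?h 1 2 1 2 y = - (partial_deriv 1 (u 1) y + partial_deriv 2 (u 2) y)"
    by (simp add: riemann_def sum_2 G' minus)
  then show ?thesis
    using pos'[of y] by (simp add: local_gauss_curvature_def sum_2 mat_def det_2 power2_eq_square)
qed

section \<open>Inverse stereographic projections; the sign \<tau> is the height of the pole at the
  centre of the chart\<close>

definition stereo :: "real \<Rightarrow> real^2 \<Rightarrow> real^3" where
  "stereo \<tau> y = (1 / (1 + (norm y)\<^sup>2)) *\<^sub>R vector [2 * y$1, \<tau> * (2 * y$2), \<tau> * (1 - (norm y)\<^sup>2)]"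

lemma stereo_N_eq: "stereo_N = stereo (-1)"
  and stereo_S_eq: "stereo_S = stereo 1"
  by (simp_all add: stereo_N_def stereo_S_def stereo_def fun_eq_iff)

lemma norm_sq_2: "(norm (y::real^2))\<^sup>2 = (y$1)\<^sup>2 + (y$2)\<^sup>2"
  unfolding power2_norm_eq_inner inner_vec_def by (simp add: sum_2 power2_eq_square)

lemma vec_nth_has_derivative:
  "((\<lambda>y::real^'n. y $ i) has_derivative (\<lambda>v. v $ i)) (at y within S)"
  by (intro bounded_linear_imp_has_derivative bounded_linear_vec_nth)

lemma norm_sq_has_derivative:
  "((\<lambda>y::real^2. (norm y)\<^sup>2) has_derivative (\<lambda>v. 2 * (y $ 1 * v $ 1 + y $ 2 * v $ 2))) (at y)"
  unfolding norm_sq_2 unfolding power2_eq_square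
  by (rule has_derivative_eq_rhs, (rule vec_nth_has_derivative has_derivative_add has_derivative_mult)+)
     (simp add: fun_eq_iff algebra_simps)

lemma one_plus_norm_sq_pos: "1 + (norm (y::real^2))\<^sup>2 > 0"
  by (simp add: add_pos_nonneg)

lemma stereo_partial_deriv:
  fixes y :: "real^2"
  defines "D \<equiv> 1 + (norm y)\<^sup>2"
  shows "partial_deriv 1 (stereo \<tau>) y
      = vector [2 / D - 4 * (y$1)\<^sup>2 / D\<^sup>2, - \<tau> * 4 * y$1 * y$2 / D\<^sup>2, - \<tau> * 4 * y$1 / D\<^sup>2]"
    and "partial_deriv 2 (stereo \<tau>) y
      = vector [- 4 * y$1 * y$2 / D\<^sup>2, \<tau> * (2 / D - 4 * (y$2)\<^sup>2 / D\<^sup>2), - \<tau> * 4 * y$2 / D\<^sup>2]"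
proof -
  have D0: "D \<noteq> 0" using one_plus_norm_sq_pos[of y] by (simp add: D_def)
  have D1: "((\<lambda>y::real^2. 1 / (1 + (norm y)\<^sup>2)) has_derivative
      (\<lambda>v. - 2 * (y $ 1 * v $ 1 + y $ 2 * v $ 2) / D\<^sup>2)) (at y)"
    unfolding D_def
    by (rule has_derivative_eq_rhs[OF has_derivative_divide[OF has_derivative_const
          has_derivative_add[OF has_derivative_const norm_sq_has_derivative]]])
       (use D0 in \<open>simp_all add: fun_eq_iff D_def field_simps power2_eq_square\<close>)
  have alt: "stereo \<tau> = (\<lambda>y. (1 / (1 + (norm y)\<^sup>2)) *\<^sub>R
      ((2 * y$1) *\<^sub>R axis 1 1 + (\<tau> * (2 * y$2)) *\<^sub>R axis 2 1 + (\<tau> * (1 - (norm y)\<^sup>2)) *\<^sub>R axis 3 1))"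
    by (simp add: stereo_def fun_eq_iff vec_eq_iff forall_3 axis_def vector_3)
  have *: "(stereo \<tau> has_derivative (\<lambda>v.
      (1 / D) *\<^sub>R ((2 * v$1) *\<^sub>R axis 1 1 + (\<tau> * (2 * v$2)) *\<^sub>R axis 2 1
          + (- \<tau> * (2 * (y $ 1 * v $ 1 + y $ 2 * v $ 2))) *\<^sub>R axis 3 1)
      + (- 2 * (y $ 1 * v $ 1 + y $ 2 * v $ 2) / D\<^sup>2) *\<^sub>R
        ((2 * y$1) *\<^sub>R axis 1 1 + (\<tau> * (2 * y$2)) *\<^sub>R axis 2 1 + (\<tau> * (1 - (norm y)\<^sup>2)) *\<^sub>R axis 3 1))) (at y)"
    unfolding alt
    by (rule has_derivative_eq_rhs, (rule D1 vec_nth_has_derivative norm_sq_has_derivative derivative_eq_intros refl)+)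
       (simp add: fun_eq_iff D_def vec_eq_iff forall_3 axis_def algebra_simps)
  have s: "(norm y)\<^sup>2 = D - 1" by (simp add: D_def)
  show "partial_deriv 1 (stereo \<tau>) y
      = vector [2 / D - 4 * (y$1)\<^sup>2 / D\<^sup>2, - \<tau> * 4 * y$1 * y$2 / D\<^sup>2, - \<tau> * 4 * y$1 / D\<^sup>2]"
    "partial_deriv 2 (stereo \<tau>) y
      = vector [- 4 * y$1 * y$2 / D\<^sup>2, \<tau> * (2 / D - 4 * (y$2)\<^sup>2 / D\<^sup>2), - \<tau> * 4 * y$2 / D\<^sup>2]"
    unfolding partial_deriv_eq[OF *] s using D0
    by (simp_all add: vec_eq_iff forall_3 axis_def vector_3 field_simps power2_eq_square)
qed

lemma stereo_nth:
  "stereo \<tau> y $ 1 = 2 * y$1 / (1 + (norm y)\<^sup>2)"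
  "stereo \<tau> y $ 2 = 2 * \<tau> * y$2 / (1 + (norm y)\<^sup>2)"
  "stereo \<tau> y $ 3 = \<tau> * (1 - (norm y)\<^sup>2) / (1 + (norm y)\<^sup>2)"
  by (simp_all add: stereo_def vector_3)

lemma inner_3: "(x::real^3) \<bullet> y = x$1 * y$1 + x$2 * y$2 + x$3 * y$3"
  by (simp add: inner_vec_def sum_3)

text \<open>The projection is conformal and, for both signs, orientation preserving: the point and
  the two coordinate vectors form a positive orthogonal frame of lengths \<open>1\<close>,
  \<open>2 / D\<close>, \<open>2 / D\<close>. The last claim is the expansion of a vector in this
  frame.\<close>

lemma stereo_geometry:
  fixes y :: "real^2"
  assumes \<tau>: "\<tau> = 1 \<or> \<tau> = -1"
  defines "D \<equiv> 1 + (norm y)\<^sup>2"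
  shows "stereo \<tau> y \<bullet> stereo \<tau> y = 1"
    and "stereo \<tau> y \<bullet> partial_deriv i (stereo \<tau>) y = 0"
    and "partial_deriv i (stereo \<tau>) y \<bullet> partial_deriv j (stereo \<tau>) y = (if i = j then 4 / D\<^sup>2 else 0)"
    and "stereo \<tau> y \<bullet> cross3 (partial_deriv 1 (stereo \<tau>) y) (partial_deriv 2 (stereo \<tau>) y) = 4 / D\<^sup>2"
    and "v = (v \<bullet> stereo \<tau> y) *\<^sub>R stereo \<tau> y
      + (D\<^sup>2 / 4 * (v \<bullet> partial_deriv 1 (stereo \<tau>) y)) *\<^sub>R partial_deriv 1 (stereo \<tau>) y
      + (D\<^sup>2 / 4 * (v \<bullet> partial_deriv 2 (stereo \<tau>) y)) *\<^sub>R partial_deriv 2 (stereo \<tau>) y"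
proof -
  obtain a b where ab: "y $ 1 = a" "y $ 2 = b" by blast
  have D: "D = 1 + a\<^sup>2 + b\<^sup>2" by (simp add: D_def norm_sq_2 ab)
  have D0: "D \<noteq> 0" using one_plus_norm_sq_pos[of y] by (simp add: D_def)
  have s: "(norm y)\<^sup>2 = D - 1" by (simp add: D_def)
  note pd = stereo_partial_deriv[of \<tau> y, folded D_def, unfolded ab]
  note x = stereo_nth[of \<tau> y, folded D_def, unfolded s ab]
  \<comment> \<open>Once the powers of \<open>D\<close> are cleared, every claim is a polynomial
    identity modulo this relation and \<open>D = 1 + a\<^sup>2 + b\<^sup>2\<close>.\<close>
  have \<tau>\<tau>: "\<tau> * \<tau> = 1" using \<tau> by auto
  show "stereo \<tau> y \<bullet> stereo \<tau> y = 1"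
    unfolding inner_3 x using D0 by (simp add: divide_simps) (use D \<tau>\<tau> in algebra)
  show "stereo \<tau> y \<bullet> partial_deriv i (stereo \<tau>) y = 0"
    using exhaust_2[of i]
  proof
    assume i: "i = 1"
    show ?thesis unfolding i inner_3 x pd vector_3 using D0
      by (simp add: divide_simps) (use D \<tau>\<tau> in algebra)
  next
    assume i: "i = 2"
    show ?thesis unfolding i inner_3 x pd vector_3 using D0
      by (simp add: divide_simps) (use D \<tau>\<tau> in algebra)
  qed
  have e11: "partial_deriv 1 (stereo \<tau>) y \<bullet> partial_deriv 1 (stereo \<tau>) y = 4 / D\<^sup>2"
    unfolding inner_3 pd vector_3 using D0 by (simp add: divide_simps) (use D \<tau>\<tau> in algebra)
  have e22: "partial_deriv 2 (stereo \<tau>) y \<bullet> partial_deriv 2 (stereo \<tau>) y = 4 / D\<^sup>2"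
    unfolding inner_3 pd vector_3 using D0 by (simp add: divide_simps) (use D \<tau>\<tau> in algebra)
  have e12: "partial_deriv 1 (stereo \<tau>) y \<bullet> partial_deriv 2 (stereo \<tau>) y = 0"
    unfolding inner_3 pd vector_3 using D0 by (simp add: divide_simps) (use D \<tau>\<tau> in algebra)
  show "partial_deriv i (stereo \<tau>) y \<bullet> partial_deriv j (stereo \<tau>) y = (if i = j then 4 / D\<^sup>2 else 0)"
    using exhaust_2[of i] exhaust_2[of j] e11 e22 e12 by (auto simp: inner_commute)
  show "stereo \<tau> y \<bullet> cross3 (partial_deriv 1 (stereo \<tau>) y) (partial_deriv 2 (stereo \<tau>) y) = 4 / D\<^sup>2"
    unfolding inner_3 cross3_def pd x vector_3 using D0
    by (simp add: divide_simps) (use D \<tau>\<tau> in algebra)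
  show "v = (v \<bullet> stereo \<tau> y) *\<^sub>R stereo \<tau> y
      + (D\<^sup>2 / 4 * (v \<bullet> partial_deriv 1 (stereo \<tau>) y)) *\<^sub>R partial_deriv 1 (stereo \<tau>) y
      + (D\<^sup>2 / 4 * (v \<bullet> partial_deriv 2 (stereo \<tau>) y)) *\<^sub>R partial_deriv 2 (stereo \<tau>) y"
    (is "v = ?r")
  proof -
    obtain v1 v2 v3 where v: "v $ 1 = v1" "v $ 2 = v2" "v $ 3 = v3" by blast
    have "v $ 1 = ?r $ 1"
      unfolding inner_3 vector_add_component vector_scaleR_component pd x vector_3 v using D0
      by (simp add: divide_simps) (use D \<tau>\<tau> in algebra)
    moreover have "v $ 2 = ?r $ 2"
      unfolding inner_3 vector_add_component vector_scaleR_component pd x vector_3 v using D0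
      by (simp add: divide_simps) (use D \<tau>\<tau> in algebra)
    moreover have "v $ 3 = ?r $ 3"
      unfolding inner_3 vector_add_component vector_scaleR_component pd x vector_3 v using D0
      by (simp add: divide_simps) (use D \<tau>\<tau> in algebra)
    ultimately show ?thesis by (simp only: vec_eq_iff forall_3)
  qed
qed

text \<open>A chart misses only the pole of height \<open>- \<tau>\<close>. The second equation
  tells how far out in the chart the point lies, which later confines a hemisphere to the unit
  disc.\<close>

lemma stereo_surj:
  assumes \<tau>: "\<tau> = 1 \<or> \<tau> = -1" and x: "x \<in> S2" and z: "1 + \<tau> * x$3 \<noteq> 0"
  obtains y where "stereo \<tau> y = x" "1 + (norm y)\<^sup>2 = 2 / (1 + \<tau> * x$3)"
proof
  let ?y = "vector [x$1 / (1 + \<tau> * x$3), \<tau> * x$2 / (1 + \<tau> * x$3)] :: real^2"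
  have "x \<bullet> x = 1" using x by (simp add: S2_def norm_eq_1)
  then have e: "x$1 * x$1 + x$2 * x$2 + x$3 * x$3 = 1" by (simp add: inner_3)
  have \<tau>\<tau>: "\<tau> * \<tau> = 1" using \<tau> by auto
  show D: "1 + (norm ?y)\<^sup>2 = 2 / (1 + \<tau> * x$3)"
    unfolding norm_sq_2 vector_2 using z
    by (simp add: power_divide divide_simps) (use e \<tau>\<tau> in algebra)
  then have s: "(norm ?y)\<^sup>2 = 2 / (1 + \<tau> * x$3) - 1" by simp
  have "stereo \<tau> ?y $ 1 = x $ 1"
    unfolding stereo_nth D vector_2 using z by simp
  moreover have "stereo \<tau> ?y $ 2 = x $ 2"
    unfolding stereo_nth D vector_2 using z \<tau>\<tau> by (simp add: mult.assoc[symmetric])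
  moreover have "stereo \<tau> ?y $ 3 = x $ 3"
    unfolding stereo_nth D unfolding s using z
    by (simp add: divide_simps) (use \<tau>\<tau> in algebra)
  ultimately show "stereo \<tau> ?y = x" by (simp only: vec_eq_iff forall_3)
qed

lemma stereo_in_S2: "\<tau> = 1 \<or> \<tau> = -1 \<Longrightarrow> stereo \<tau> y \<in> S2"
  using stereo_geometry(1)[of \<tau> y] by (simp add: S2_def norm_eq_1)

lemma S2_nth_le:
  assumes "x \<in> S2" shows "\<bar>x $ i\<bar> \<le> 1"
  using component_le_norm_cart[of x i] assms by (simp add: S2_def)

section \<open>Derivatives of radial functions and of their products with a coordinate\<close>

lemma radial_has_derivative:
  assumes "(f has_real_derivative f') (at ((norm y)\<^sup>2))"
  shows "((\<lambda>y::real^2. f ((norm y)\<^sup>2)) has_derivative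
    (\<lambda>v. f' * (2 * (y $ 1 * v $ 1 + y $ 2 * v $ 2)))) (at y)"
  using has_derivative_compose[OF norm_sq_has_derivative assms[unfolded has_field_derivative_def]]
  by simp

lemma partial_deriv_radial:
  fixes y :: "real^2"
  assumes "(f has_real_derivative f') (at ((norm y)\<^sup>2))"
  shows "partial_deriv i (\<lambda>y::real^2. f ((norm y)\<^sup>2)) y = 2 * y $ i * f'"
  unfolding partial_deriv_eq[OF radial_has_derivative[OF assms]]
  using exhaust_2[of i] by (auto simp: axis_def)

lemma nth_mult_radial_has_derivative:
  assumes "(f has_real_derivative f') (at ((norm y)\<^sup>2))"
  shows "((\<lambda>y::real^2. y $ j * f ((norm y)\<^sup>2)) has_derivative
    (\<lambda>v. y $ j * (f' * (2 * (y $ 1 * v $ 1 + y $ 2 * v $ 2))) + v $ j * f ((norm y)\<^sup>2))) (at y)"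
  using has_derivative_mult[OF vec_nth_has_derivative radial_has_derivative[OF assms]] .

lemma partial_deriv_nth_mult_radial:
  fixes y :: "real^2"
  assumes "(f has_real_derivative f') (at ((norm y)\<^sup>2))"
  shows "partial_deriv i (\<lambda>y::real^2. y $ j * f ((norm y)\<^sup>2)) y
    = 2 * y $ i * y $ j * f' + (if i = j then f ((norm y)\<^sup>2) else 0)"
  unfolding partial_deriv_eq[OF nth_mult_radial_has_derivative[OF assms]]
  using exhaust_2[of i] exhaust_2[of j] by (auto simp: axis_def)

section \<open>The teardrop metric in a chart\<close>

definition weight :: "real \<Rightarrow> real^3 \<Rightarrow> real" where
  "weight \<delta> x = ((1 + x$3) + \<delta>\<^sup>2 * (1 - x$3)) / 2"

definition teardrop :: "real \<Rightarrow> metric" where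
  "teardrop \<delta> x v w = (1 + \<delta>) / (2 * sqrt (weight \<delta> x)) * (v \<bullet> w)"

text \<open>The integral of \<open>(1 - K) \<mu>\<close> over the cap where \<open>weight \<le> r\<^sup>2\<close> is
  \<open>2 \<pi> profile \<delta> r (1 - r\<^sup>2) (r\<^sup>2 - \<delta>\<^sup>2) / (1 - \<delta>\<^sup>2)\<close>; differentiating this in \<open>r\<close> gives the
  differential equation below.\<close>

definition profile :: "real \<Rightarrow> real \<Rightarrow> real" where
  "profile \<delta> r = 2 / ((1 + r) * (r + \<delta>)) - 1 / (2 * r\<^sup>2)"

text \<open>The last factor is the angular form times the squared distance from the axis, which
  keeps the form smooth at the poles. The minus sign appears because caps around the south pole have
  their boundary oriented against increasing angle.\<close>

definition primitive :: "real \<Rightarrow> form1" where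
  "primitive \<delta> x v = - ((1 - \<delta>\<^sup>2) / 4) * profile \<delta> (sqrt (weight \<delta> x)) * (x$1 * v$2 - x$2 * v$1)"

definition profile' :: "real \<Rightarrow> real \<Rightarrow> real" where
  "profile' \<delta> r = 1 / r ^ 3 - 2 * (2 * r + 1 + \<delta>) / ((1 + r) * (r + \<delta>))\<^sup>2"

lemma profile_deriv:
  assumes "r > 0" "\<delta> > 0"
  shows "(profile \<delta> has_real_derivative profile' \<delta> r) (at r)"
proof -
  have "r \<noteq> 0" "1 + r \<noteq> 0" "r + \<delta> \<noteq> 0" using assms by simp_all
  then show ?thesis
    unfolding profile_def[abs_def] profile'_def
    by - (rule DERIV_cong, (rule derivative_eq_intros refl | (simp; fail))+,
       simp add: divide_simps, algebra)
qed

text \<open>On the left stands the derivative of \<open>profile \<delta> r * (1 - r\<^sup>2) *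
  (r\<^sup>2 - \<delta>\<^sup>2)\<close> divided by \<open>r\<close>. On the right, up to a common
  factor, the first term is the area density and the other two are the curvature density.\<close>

lemma profile_ode:
  assumes "r > 0" "\<delta> > 0"
  shows "(1 - r\<^sup>2) * (r\<^sup>2 - \<delta>\<^sup>2) * profile' \<delta> r / r + 2 * (1 + \<delta>\<^sup>2 - 2 * r\<^sup>2) * profile \<delta> r
    = 2 * (1 + \<delta>) / r - \<delta>\<^sup>2 / r ^ 4 - 3"
proof -
  have "r \<noteq> 0" "1 + r \<noteq> 0" "r + \<delta> \<noteq> 0" using assms by simp_all
  then show ?thesis
    unfolding profile_def profile'_def by (simp add: divide_simps) algebra
qed

locale teardrop_param =
  fixes \<delta> :: real
  assumes \<delta>_pos: "0 < \<delta>" and \<delta>_less_1: "\<delta> < 1"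

locale teardrop_chart = teardrop_param +
  fixes \<tau> :: real
  assumes \<tau>: "\<tau> = 1 \<or> \<tau> = -1"
begin

text \<open>With \<open>s = |y|\<^sup>2\<close>, \<open>\<rho>\<close> is the conformal factor in the chart, \<open>\<psi>\<close> its logarithmic derivative, and the
  primitive reads \<open>b (y\<^sub>1 dy\<^sub>2 - y\<^sub>2 dy\<^sub>1)\<close>.\<close>

definition p where "p = ((1 + \<tau>) + \<delta>\<^sup>2 * (1 - \<tau>)) / 2"
definition q where "q = ((1 - \<tau>) + \<delta>\<^sup>2 * (1 + \<tau>)) / 2"
definition W where "W s = (p + q * s) / (1 + s)"
definition \<rho> where "\<rho> s = 2 * (1 + \<delta>) / (sqrt (W s) * (1 + s)\<^sup>2)"
definition \<psi> where "\<psi> s = - q / (2 * (p + q * s)) - 3 / (2 * (1 + s))"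
definition b where "b s = - \<tau> * (1 - \<delta>\<^sup>2) * profile \<delta> (sqrt (W s)) / (1 + s)\<^sup>2"

lemma p_pos: "p > 0" and q_pos: "q > 0"
  using \<tau> \<delta>_pos by (auto simp: p_def q_def)

text \<open>\<open>p\<close> and \<open>q\<close> are the weights of the pole at the centre and of
  the pole that the chart omits: the numbers \<open>1\<close> and \<open>\<delta>\<^sup>2\<close>,
  in the order dictated by \<tau>. Through these relations both charts are treated at once.\<close>

lemma pq: "p * q = \<delta>\<^sup>2" "p + q = 1 + \<delta>\<^sup>2" "p - q = \<tau> * (1 - \<delta>\<^sup>2)"
  using \<tau> by (auto simp: p_def q_def field_simps)

lemma N_pos: "s \<ge> 0 \<Longrightarrow> p + q * s > 0"
  using p_pos q_pos by (simp add: add_pos_nonneg)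

lemma W_pos: "s \<ge> 0 \<Longrightarrow> W s > 0"
  using N_pos[of s] by (simp add: W_def)

lemma \<rho>_pos: "s \<ge> 0 \<Longrightarrow> \<rho> s > 0"
  using W_pos[of s] \<delta>_pos by (simp add: \<rho>_def)

lemma weight_stereo: "weight \<delta> (stereo \<tau> y) = W ((norm y)\<^sup>2)"
proof -
  have "1 + (norm y)\<^sup>2 \<noteq> 0" using one_plus_norm_sq_pos[of y] by simp
  then show ?thesis
    unfolding weight_def stereo_nth W_def p_def q_def
    by (simp add: divide_simps) algebra
qed

lemma pullback2_teardrop:
  "pullback2 (stereo \<tau>) (teardrop \<delta>) i j y = (if i = j then \<rho> ((norm y)\<^sup>2) else 0)"
  by (simp add: pullback2_def teardrop_def weight_stereo stereo_geometry(3)[OF \<tau>] \<rho>_def divide_simps)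

lemma pullback2_area_form:
  "pullback2 (stereo \<tau>) (area_form (teardrop \<delta>)) 1 2 y = \<rho> ((norm y)\<^sup>2)"
proof -
  let ?g = "\<lambda>i j. teardrop \<delta> (stereo \<tau> y) (partial_deriv i (stereo \<tau>) y) (partial_deriv j (stereo \<tau>) y)"
  have g: "?g i j = (if i = j then \<rho> ((norm y)\<^sup>2) else 0)" for i j
    using pullback2_teardrop[of i j y] by (simp add: pullback2_def)
  have "sgn (stereo \<tau> y \<bullet> cross3 (partial_deriv 1 (stereo \<tau>) y) (partial_deriv 2 (stereo \<tau>) y)) = 1"
    using one_plus_norm_sq_pos[of y] by (simp add: stereo_geometry(4)[OF \<tau>])
  then show ?thesis
    using \<rho>_pos[of "(norm y)\<^sup>2"] by (simp add: pullback2_def area_form_def g real_sqrt_mult)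
qed

lemma pullback1_primitive:
  "pullback1 (stereo \<tau>) (primitive \<delta>) i y
    = (if i = 1 then - (y $ 2 * b ((norm y)\<^sup>2)) else y $ 1 * b ((norm y)\<^sup>2))"
proof -
  define D where "D = 1 + (norm y)\<^sup>2"
  have D0: "D \<noteq> 0" using one_plus_norm_sq_pos[of y] by (simp add: D_def)
  have D: "D = 1 + (y$1)\<^sup>2 + (y$2)\<^sup>2" by (simp add: D_def norm_sq_2)
  have D': "1 + (norm y)\<^sup>2 = D" by (simp add: D_def)
  note pd = stereo_partial_deriv[of \<tau> y, folded D_def]
  note x = stereo_nth[of \<tau> y, folded D_def]
  have 1: "stereo \<tau> y $ 1 * partial_deriv 1 (stereo \<tau>) y $ 2
      - stereo \<tau> y $ 2 * partial_deriv 1 (stereo \<tau>) y $ 1 = - 4 * \<tau> * y $ 2 / D\<^sup>2"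
    unfolding x pd vector_3 using D0 by (simp add: divide_simps) algebra
  have 2: "stereo \<tau> y $ 1 * partial_deriv 2 (stereo \<tau>) y $ 2
      - stereo \<tau> y $ 2 * partial_deriv 2 (stereo \<tau>) y $ 1 = 4 * \<tau> * y $ 1 / D\<^sup>2"
    unfolding x pd vector_3 using D0 by (simp add: divide_simps) algebra
  show ?thesis
    using exhaust_2[of i] 1 2
    by (auto simp: pullback1_def primitive_def weight_stereo b_def D')
qed

section \<open>Radial derivatives in a chart and the differential equation for the primitive\<close>

lemma W_deriv: "s \<ge> 0 \<Longrightarrow> (W has_real_derivative - (p - q) / (1 + s)\<^sup>2) (at s)"
  unfolding W_def[abs_def]
  by (auto intro!: derivative_eq_intros simp: power2_eq_square divide_simps algebra_simps)

lemma sqrt_W_deriv: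
  assumes "s \<ge> 0"
  shows "((\<lambda>s. sqrt (W s)) has_real_derivative - (p - q) / (2 * sqrt (W s) * (1 + s)\<^sup>2)) (at s)"
proof -
  have "((\<lambda>s. sqrt (W s)) has_real_derivative
      inverse (sqrt (W s)) / 2 * (- (p - q) / (1 + s)\<^sup>2)) (at s)"
    by (rule DERIV_chain2[OF DERIV_real_sqrt[OF W_pos[OF assms]] W_deriv[OF assms]])
  then show ?thesis
    by (rule DERIV_cong) (simp add: field_simps)
qed

text \<open>Up to a constant, \<open>log \<rho>\<close> is
  \<open>-1/2 log (p + q s) - 3/2 log (1 + s)\<close>, because the denominator of \<open>W\<close>
  cancels part of \<open>(1 + s)\<^sup>2\<close>; \<psi> is its derivative.\<close>

lemma \<rho>_deriv:
  assumes "s \<ge> 0"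
  shows "(\<rho> has_real_derivative \<rho> s * \<psi> s) (at s)"
proof -
  define r where "r = sqrt (W s)"
  have r: "r > 0" "r\<^sup>2 * (1 + s) = p + q * s"
    using W_pos[OF assms] assms by (simp_all add: r_def W_def)
  have N: "p + q * s \<noteq> 0" using N_pos[OF assms] by simp
  have "(\<rho> has_real_derivative (0 * (r * (1 + s)\<^sup>2) - 2 * (1 + \<delta>) *
      ((- (p - q) / (2 * r * (1 + s)\<^sup>2)) * (1 + s)\<^sup>2 + (2 * (1 + s)) * r))
      / ((r * (1 + s)\<^sup>2) * (r * (1 + s)\<^sup>2))) (at s)"
    unfolding \<rho>_def[abs_def] r_def using r(1) assms
    by (intro DERIV_divide DERIV_mult sqrt_W_deriv)
       (auto intro!: derivative_eq_intros simp: r_def)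
  moreover have "(0 * (r * (1 + s)\<^sup>2) - 2 * (1 + \<delta>) *
      ((- (p - q) / (2 * r * (1 + s)\<^sup>2)) * (1 + s)\<^sup>2 + (2 * (1 + s)) * r))
      / ((r * (1 + s)\<^sup>2) * (r * (1 + s)\<^sup>2)) = \<rho> s * \<psi> s"
  proof -
    have \<psi>: "\<psi> s = - q / (2 * (r\<^sup>2 * (1 + s))) - 3 / (2 * (1 + s))"
      by (simp add: \<psi>_def r)
    have "r \<noteq> 0" "1 + s \<noteq> 0" using r assms by auto
    then show ?thesis
      unfolding \<rho>_def \<psi> r_def[symmetric]
      by (simp add: divide_simps) (use r(2) in algebra)
  qed
  ultimately show ?thesis by simp
qed

lemma \<psi>_deriv:
  assumes "s \<ge> 0"
  shows "(\<psi> has_real_derivative q\<^sup>2 / (2 * (p + q * s)\<^sup>2) + 3 / (2 * (1 + s)\<^sup>2)) (at s)"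
proof -
  have "p + q * s \<noteq> 0" "1 + s \<noteq> 0" using N_pos[OF assms] assms by auto
  then show ?thesis
    unfolding \<psi>_def[abs_def]
    by - (rule DERIV_cong, (rule derivative_eq_intros refl | (simp; fail))+,
       simp add: divide_simps, algebra)
qed

lemma b_deriv:
  assumes "s \<ge> 0"
  shows "(b has_real_derivative - \<tau> * (1 - \<delta>\<^sup>2) *
    (- (p - q) * profile' \<delta> (sqrt (W s)) / (2 * sqrt (W s) * (1 + s) ^ 4)
     - 2 * profile \<delta> (sqrt (W s)) / (1 + s) ^ 3)) (at s)"
proof -
  have r: "sqrt (W s) > 0" using W_pos[OF assms] by simp
  have "((\<lambda>s. profile \<delta> (sqrt (W s))) has_real_derivative
      profile' \<delta> (sqrt (W s)) * (- (p - q) / (2 * sqrt (W s) * (1 + s)\<^sup>2))) (at s)"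
    by (rule DERIV_chain2[OF profile_deriv[OF r \<delta>_pos] sqrt_W_deriv[OF assms]])
  moreover have "1 + s \<noteq> 0" using assms by simp
  ultimately show ?thesis
    unfolding b_def[abs_def] using r
    by - (rule DERIV_cong, (rule derivative_eq_intros refl | assumption | (simp; fail))+,
       simp add: divide_simps power_numeral_reduce, algebra)
qed

text \<open>The left side is the coefficient of the exterior derivative of
  \<open>b (y1 dy2 - y2 dy1)\<close>, the right side that of \<open>(1 - K) \<mu>\<close>.
  Multiplied by \<open>(1 + s)\<^sup>2\<close> and written in \<open>r = sqrt (W s)\<close>, the
  equation turns into \<open>profile_ode\<close>, the same for both charts.\<close>

lemma b_ode:
  assumes "s \<ge> 0" "(b has_real_derivative b') (at s)"
  shows "2 * b s + 2 * s * b' = \<rho> s - \<delta>\<^sup>2 / (p + q * s)\<^sup>2 - 3 / (1 + s)\<^sup>2"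
proof -
  define r where "r = sqrt (W s)"
  have r: "r > 0" "r\<^sup>2 * (1 + s) = p + q * s"
    using W_pos[OF assms(1)] assms(1) by (simp_all add: r_def W_def)
  define D where "D = 1 + s"
  have nz: "r \<noteq> 0" "D \<noteq> 0" using r assms(1) by (auto simp: D_def)
  have b': "b' = - (p - q) *
      (- (p - q) * profile' \<delta> r / (2 * r * D ^ 4) - 2 * profile \<delta> r / D ^ 3)"
    using DERIV_unique[OF assms(2) b_deriv[OF assms(1)]] by (simp add: r_def D_def pq(3))
  have b: "b s = - (p - q) * profile \<delta> r / D\<^sup>2"
    by (simp add: b_def r_def D_def pq(3))
  have rD: "r\<^sup>2 * D = p + q * (D - 1)" using r by (simp add: D_def)
  \<comment> \<open>These two relations trade the chart variable for \<open>r\<close>, so that only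
    \<open>p\<close>, \<open>q\<close> and \<open>r\<close> remain.\<close>
  have k: "p - q = D * (r\<^sup>2 - q)" "(D - 1) * (r\<^sup>2 - q) = p - r\<^sup>2"
    using rD by algebra+
  have "D\<^sup>2 * (2 * b s + 2 * s * b') = (p - r\<^sup>2) * (r\<^sup>2 - q) * profile' \<delta> r / r
      + 2 * (p + q - 2 * r\<^sup>2) * profile \<delta> r"
  proof -
    have "D\<^sup>2 * (2 * b s + 2 * s * b') = - 2 * (p - q) * profile \<delta> r
      + (D - 1) * (p - q) * ((p - q) / D) * profile' \<delta> r / (r * D) + 4 * (D - 1) * ((p - q) / D) * profile \<delta> r"
      unfolding b b' using nz
      by (simp add: D_def[symmetric] divide_simps power_numeral_reduce) (use D_def in algebra)
    also have "\<dots> = - 2 * (p - q) * profile \<delta> r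
      + (p - r\<^sup>2) * (r\<^sup>2 - q) * profile' \<delta> r / r + 4 * (p - r\<^sup>2) * profile \<delta> r"
      using nz unfolding k(1) by (simp add: k(2)[symmetric] divide_simps)
    also have "\<dots> = (p - r\<^sup>2) * (r\<^sup>2 - q) * profile' \<delta> r / r
      + 2 * (p + q - 2 * r\<^sup>2) * profile \<delta> r"
      by algebra
    finally show ?thesis .
  qed
  \<comment> \<open>The product is symmetric in \<open>p\<close> and \<open>q\<close>, so their
    order, and with it \<tau>, disappears.\<close>
  also have "(p - r\<^sup>2) * (r\<^sup>2 - q) = (1 - r\<^sup>2) * (r\<^sup>2 - \<delta>\<^sup>2)"
    using pq(1,2) by algebra
  also have "(1 - r\<^sup>2) * (r\<^sup>2 - \<delta>\<^sup>2) * profile' \<delta> r / r + 2 * (p + q - 2 * r\<^sup>2) * profile \<delta> r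
      = 2 * (1 + \<delta>) / r - \<delta>\<^sup>2 / r ^ 4 - 3"
    using profile_ode[OF r(1) \<delta>_pos] by (simp add: pq(2))
  also have "\<dots> = D\<^sup>2 * (\<rho> s - \<delta>\<^sup>2 / (r\<^sup>2 * D)\<^sup>2 - 3 / D\<^sup>2)"
    unfolding \<rho>_def r_def[symmetric] D_def[symmetric] using nz
    by (simp add: field_simps power_mult_distrib)
  finally show ?thesis
    using nz r(2) by (simp add: D_def)
qed

end

section \<open>Smoothness, curvature and exterior derivative in a chart\<close>

context teardrop_chart
begin

lemma smooth_profile:
  assumes "smooth f" "\<And>y. f y > 0"
  shows "smooth (\<lambda>y. profile \<delta> (f y))"
  unfolding profile_def power2_eq_square using assms \<delta>_pos
  by (intro smooth_diff smooth_divide smooth_mult smooth_add smooth_const)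
     (auto intro!: mult_pos_pos add_pos_pos)

lemma smooth_W: "smooth (\<lambda>y. W ((norm y)\<^sup>2))"
  unfolding W_def using N_pos one_plus_norm_sq_pos
  by (intro smooth_divide smooth_add smooth_mult smooth_norm_sq) auto

lemma smooth_pullback2: "smooth (pullback2 (stereo \<tau>) (teardrop \<delta>) i j)"
proof -
  have "smooth (\<lambda>y. \<rho> ((norm y)\<^sup>2))"
    unfolding \<rho>_def power2_eq_square[of "1 + _"] using W_pos one_plus_norm_sq_pos
    by (intro smooth_divide smooth_add smooth_mult smooth_sqrt smooth_norm_sq smooth_W)
       (auto intro!: mult_pos_pos)
  then show ?thesis
    by (cases "i = j") (simp_all add: pullback2_teardrop[abs_def])
qed

lemma smooth_pullback1: "smooth (pullback1 (stereo \<tau>) (primitive \<delta>) i)"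
proof -
  have "smooth (\<lambda>y. profile \<delta> (sqrt (W ((norm y)\<^sup>2))))"
    using W_pos by (intro smooth_profile smooth_sqrt smooth_W) auto
  then have "smooth (\<lambda>y. b ((norm y)\<^sup>2))"
    unfolding b_def power2_eq_square[of "1 + _"] using one_plus_norm_sq_pos
    by (intro smooth_divide smooth_mult smooth_add smooth_norm_sq) (auto intro!: mult_pos_pos)
  then have "smooth (\<lambda>y. y $ j * b ((norm y)\<^sup>2))" for j
    by (intro smooth_mult smooth_nth)
  then show ?thesis
    using smooth_diff[OF smooth_const[of 0]]
    by (cases "i = 1") (fastforce simp: pullback1_primitive[abs_def])+
qed

text \<open>The half gradient of the logarithm of the conformal factor is
  \<open>y $ i * \<psi> s\<close>, with divergence \<open>2 \<psi> + 2 s \<psi>'\<close>. The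
  numerator \<open>\<delta>\<^sup>2\<close> is \<open>p * q\<close>, left over from
  \<open>q (p + q s) - q\<^sup>2 s\<close>.\<close>

lemma local_gauss_curvature_teardrop:
  defines "s \<equiv> \<lambda>y::real^2. (norm y)\<^sup>2"
  shows "local_gauss_curvature (metric_matrix (stereo \<tau>) (teardrop \<delta>)) y
    = (\<delta>\<^sup>2 / (p + q * s y)\<^sup>2 + 3 / (1 + s y)\<^sup>2) / \<rho> (s y)"
proof -
  let ?u = "\<lambda>i y::real^2. y $ i * \<psi> ((norm y)\<^sup>2)"
  have s0: "s y \<ge> 0" by (simp add: s_def)
  have mat: "metric_matrix (stereo \<tau>) (teardrop \<delta>) = (\<lambda>y. mat (\<rho> ((norm y)\<^sup>2)))"
    by (simp add: metric_matrix_def pullback2_teardrop mat_def fun_eq_iff)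
  have "local_gauss_curvature (metric_matrix (stereo \<tau>) (teardrop \<delta>)) y
    = - (partial_deriv 1 (?u 1) y + partial_deriv 2 (?u 2) y) / \<rho> ((norm y)\<^sup>2)"
    unfolding mat
  proof (rule local_gauss_curvature_conformal)
    show "0 < \<rho> ((norm y)\<^sup>2)" for y :: "real^2" by (simp add: \<rho>_pos)
    show "partial_deriv i (\<lambda>y. \<rho> ((norm y)\<^sup>2)) y = 2 * \<rho> ((norm y)\<^sup>2) * ?u i y" for i y
      by (subst partial_deriv_radial[OF \<rho>_deriv]) simp_all
    show "?u i differentiable (at y)" for i y
      by (rule differentiableI[OF nth_mult_radial_has_derivative[OF \<psi>_deriv]]) simp
  qed
  moreover have "- (partial_deriv 1 (?u 1) y + partial_deriv 2 (?u 2) y)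
      = \<delta>\<^sup>2 / (p + q * s y)\<^sup>2 + 3 / (1 + s y)\<^sup>2"
  proof -
    have "partial_deriv i (?u i) y
        = 2 * y $ i * y $ i * (q\<^sup>2 / (2 * (p + q * s y)\<^sup>2) + 3 / (2 * (1 + s y)\<^sup>2)) + \<psi> (s y)" for i
      by (subst partial_deriv_nth_mult_radial[OF \<psi>_deriv]) (simp_all add: s_def)
    note D = this[of 1] this[of 2]
    have "- (partial_deriv 1 (?u 1) y + partial_deriv 2 (?u 2) y)
      = - 2 * ((y$1)\<^sup>2 + (y$2)\<^sup>2) * (q\<^sup>2 / (2 * (p + q * s y)\<^sup>2) + 3 / (2 * (1 + s y)\<^sup>2)) - 2 * \<psi> (s y)"
      unfolding D by algebra
    also have "(y$1)\<^sup>2 + (y$2)\<^sup>2 = s y"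
      by (simp add: s_def norm_sq_2)
    also have "- 2 * s y * (q\<^sup>2 / (2 * (p + q * s y)\<^sup>2) + 3 / (2 * (1 + s y)\<^sup>2)) - 2 * \<psi> (s y)
      = p * q / (p + q * s y)\<^sup>2 + 3 / (1 + s y)\<^sup>2"
    proof -
      have "p + q * s y \<noteq> 0" "1 + s y \<noteq> 0" using N_pos[OF s0] s0 by auto
      then show ?thesis unfolding \<psi>_def by (simp add: divide_simps) algebra
    qed
    finally show ?thesis by (simp add: pq(1))
  qed
  ultimately show ?thesis by (simp add: s_def)
qed

text \<open>Rewriting the curvature in the weight alone makes it visibly independent of the chart,
  so no general invariance of curvature under change of coordinates has to be proved. Positivity can
  also be read off.\<close>

lemma local_gauss_curvature_weight:
  "local_gauss_curvature (metric_matrix (stereo \<tau>) (teardrop \<delta>)) y =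
    (let w = weight \<delta> (stereo \<tau> y) in sqrt w / (2 * (1 + \<delta>)) * (3 + \<delta>\<^sup>2 / w\<^sup>2))"
proof -
  define s where "s = (norm y)\<^sup>2"
  define D where "D = 1 + s"
  have D: "D \<noteq> 0" using one_plus_norm_sq_pos[of y] by (simp add: D_def s_def)
  have w: "W s > 0" by (rule W_pos) (simp add: s_def)
  define r where "r = sqrt (W s)"
  have r: "r > 0" "W s = r\<^sup>2" using w by (simp_all add: r_def)
  have N: "p + q * s = r\<^sup>2 * D" using D by (simp add: r(2)[symmetric] W_def D_def)
  have "1 + \<delta> \<noteq> 0" using \<delta>_pos by simp
  then show ?thesis
    unfolding local_gauss_curvature_teardrop weight_stereo Let_def s_def[symmetric] \<rho>_def N
      r_def[symmetric] D_def[symmetric] r(2)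
    using D r(1) by (simp add: divide_simps power_mult_distrib)
qed

lemma exterior_deriv_primitive:
  "partial_deriv 1 (pullback1 (stereo \<tau>) (primitive \<delta>) 2) y
    - partial_deriv 2 (pullback1 (stereo \<tau>) (primitive \<delta>) 1) y
    = (1 - local_gauss_curvature (metric_matrix (stereo \<tau>) (teardrop \<delta>)) y) *
      pullback2 (stereo \<tau>) (area_form (teardrop \<delta>)) 1 2 y"
proof -
  define s where "s = (norm y)\<^sup>2"
  have s: "s \<ge> 0" by (simp add: s_def)
  obtain b' where b': "(b has_real_derivative b') (at s)"
    using b_deriv[OF s] by blast
  have minus: "pullback1 (stereo \<tau>) (primitive \<delta>) 1 = (\<lambda>y. y $ 2 * (\<lambda>s. - b s) ((norm y)\<^sup>2))"
    and plus: "pullback1 (stereo \<tau>) (primitive \<delta>) 2 = (\<lambda>y. y $ 1 * b ((norm y)\<^sup>2))"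
    by (simp_all add: pullback1_primitive fun_eq_iff)
  have "partial_deriv 1 (pullback1 (stereo \<tau>) (primitive \<delta>) 2) y
    - partial_deriv 2 (pullback1 (stereo \<tau>) (primitive \<delta>) 1) y = 2 * b s + 2 * ((y$1)\<^sup>2 + (y$2)\<^sup>2) * b'"
    unfolding minus plus partial_deriv_nth_mult_radial[OF b'[unfolded s_def]]
      partial_deriv_nth_mult_radial[OF DERIV_minus[OF b'[unfolded s_def]]]
    by (simp add: s_def power2_eq_square algebra_simps)
  also have "(y$1)\<^sup>2 + (y$2)\<^sup>2 = s"
    by (simp add: s_def norm_sq_2)
  also have "2 * b s + 2 * s * b' = \<rho> s - \<delta>\<^sup>2 / (p + q * s)\<^sup>2 - 3 / (1 + s)\<^sup>2"
    by (rule b_ode[OF s b'])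
  also have "\<dots> = (1 - (\<delta>\<^sup>2 / (p + q * s)\<^sup>2 + 3 / (1 + s)\<^sup>2) / \<rho> s) * \<rho> s"
    using \<rho>_pos[OF s] by (simp add: left_diff_distrib)
  finally show ?thesis
    by (simp add: local_gauss_curvature_teardrop pullback2_area_form s_def)
qed

end

section \<open>The teardrop metric on the sphere\<close>

context teardrop_param
begin

lemma chart: "\<tau> = 1 \<or> \<tau> = -1 \<Longrightarrow> teardrop_chart \<delta> \<tau>"
  by unfold_locales

lemma atlas_cases:
  assumes "\<phi> \<in> atlas"
  obtains \<tau> where "\<phi> = stereo \<tau>" "\<tau> = 1 \<or> \<tau> = -1" "teardrop_chart \<delta> \<tau>"
  using assms that[of 1] that[of "-1"] chart by (auto simp: atlas_def stereo_N_eq stereo_S_eq)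

lemma weight_bounds:
  assumes "x \<in> S2" shows "0 < weight \<delta> x" "weight \<delta> x \<le> 1"
proof -
  have z: "- 1 \<le> x $ 3" "x $ 3 \<le> 1" using S2_nth_le[OF assms, of 3] by auto
  have d: "0 < \<delta>\<^sup>2" "\<delta>\<^sup>2 \<le> 1" using \<delta>_pos \<delta>_less_1 by (auto simp: power_le_one)
  show "0 < weight \<delta> x"
  proof (cases "x $ 3 = -1")
    case False
    then have "1 + x $ 3 > 0" using z by simp
    then show ?thesis using z d by (simp add: weight_def add_pos_nonneg)
  qed (use \<delta>_pos in \<open>simp add: weight_def\<close>)
  have "\<delta>\<^sup>2 * (1 - x $ 3) \<le> 1 * (1 - x $ 3)"
    using z d by (intro mult_right_mono) auto
  then show "weight \<delta> x \<le> 1" by (simp add: weight_def)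
qed

lemma riemannian_metric_teardrop: "riemannian_metric (teardrop \<delta>)"
  unfolding riemannian_metric_def
proof (intro conjI ballI allI impI)
  show "bilinear (teardrop \<delta> x)" for x
    by (simp add: bilinear_def linear_iff teardrop_def inner_add_left inner_add_right distrib_left add_divide_distrib mult.left_commute)
  show "teardrop \<delta> x v w = teardrop \<delta> x w v" for x v w
    by (simp add: teardrop_def inner_commute)
  show "teardrop \<delta> x v v > 0" if "x \<in> S2" "v \<noteq> 0" for x v
    using weight_bounds(1)[OF that(1)] that(2) \<delta>_pos by (simp add: teardrop_def)
  show "smooth (pullback2 \<phi> (teardrop \<delta>) i j)" if "\<phi> \<in> atlas" for \<phi> i j
    using that by (elim atlas_cases) (simp add: teardrop_chart.smooth_pullback2)
qed

lemma gauss_curvature_teardrop: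
  assumes "x \<in> S2"
  shows "gauss_curvature (teardrop \<delta>) x =
    (let w = weight \<delta> x in sqrt w / (2 * (1 + \<delta>)) * (3 + \<delta>\<^sup>2 / w\<^sup>2))"
proof -
  \<comment> \<open>\<open>chart_at\<close> never selects a chart whose omitted pole is
    \<open>x\<close> itself: on the sphere, height 1 is attained only at the north pole.\<close>
  obtain \<tau> where \<tau>: "\<tau> = 1 \<or> \<tau> = -1" "chart_at x = stereo \<tau>" "1 + \<tau> * x$3 \<noteq> 0"
  proof (cases "x = vector [0, 0, 1]")
    case True
    then show thesis using that[of 1] by (simp add: chart_at_def stereo_S_eq vector_3)
  next
    case False
    have "x $ 3 \<noteq> 1"
    proof
      assume z: "x $ 3 = 1"
      have "x \<bullet> x = 1" using assms by (simp add: S2_def norm_eq_1)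
      then have "x$1 * x$1 + x$2 * x$2 = 0" using z by (simp add: inner_3)
      then have "x$1 = 0" "x$2 = 0" by (simp_all add: sum_squares_eq_zero_iff)
      then show False using False z by (simp add: vec_eq_iff forall_3 vector_3)
    qed
    then show thesis using that[of "-1"] False by (simp add: chart_at_def stereo_N_eq)
  qed
  have "x \<in> range (stereo \<tau>)"
    using stereo_surj[OF \<tau>(1) assms \<tau>(3)] by (metis rangeI)
  \<comment> \<open>\<open>inv\<close> chooses some preimage, and the curvature formula sees only
    the image of that preimage.\<close>
  then have "stereo \<tau> (inv (stereo \<tau>) x) = x" by (rule f_inv_into_f)
  then show ?thesis
    unfolding gauss_curvature_def \<tau>(2)
    using teardrop_chart.local_gauss_curvature_weight[OF chart[OF \<tau>(1)], of "inv (stereo \<tau>) x"] by simp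
qed

lemma gauss_curvature_stereo:
  assumes "\<tau> = 1 \<or> \<tau> = -1"
  shows "gauss_curvature (teardrop \<delta>) (stereo \<tau> y)
    = local_gauss_curvature (metric_matrix (stereo \<tau>) (teardrop \<delta>)) y"
  unfolding gauss_curvature_teardrop[OF stereo_in_S2[OF assms]]
    teardrop_chart.local_gauss_curvature_weight[OF chart[OF assms]] ..

lemma gauss_curvature_nonneg: "x \<in> S2 \<Longrightarrow> gauss_curvature (teardrop \<delta>) x \<ge> 0"
  using weight_bounds(1)[of x] \<delta>_pos by (simp add: gauss_curvature_teardrop Let_def)

lemma one_form_primitive: "one_form (primitive \<delta>)"
  unfolding one_form_def
proof (intro conjI ballI allI)
  show "linear (primitive \<delta> x)" for x
  proof (rule linearI)
    show "primitive \<delta> x (v + w) = primitive \<delta> x v + primitive \<delta> x w" for v w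
      unfolding primitive_def vector_add_component by algebra
    show "primitive \<delta> x (c *\<^sub>R v) = c *\<^sub>R primitive \<delta> x v" for c v
      unfolding primitive_def vector_scaleR_component real_scaleR_def by algebra
  qed
  show "smooth (pullback1 \<phi> (primitive \<delta>) i)" if "\<phi> \<in> atlas" for \<phi> i
    using that by (elim atlas_cases) (simp add: teardrop_chart.smooth_pullback1)
qed

lemma has_exterior_deriv_primitive:
  "has_exterior_deriv (primitive \<delta>)
    (\<lambda>x v w. (1 - gauss_curvature (teardrop \<delta>) x) * area_form (teardrop \<delta>) x v w)"
  unfolding has_exterior_deriv_def
proof (intro ballI allI)
  fix \<phi> y assume "\<phi> \<in> atlas"
  then obtain \<tau> where \<tau>: "\<phi> = stereo \<tau>" "\<tau> = 1 \<or> \<tau> = -1" "teardrop_chart \<delta> \<tau>"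
    by (rule atlas_cases)
  show "partial_deriv 1 (pullback1 \<phi> (primitive \<delta>) 2) y - partial_deriv 2 (pullback1 \<phi> (primitive \<delta>) 1) y
    = pullback2 \<phi> (\<lambda>x v w. (1 - gauss_curvature (teardrop \<delta>) x) * area_form (teardrop \<delta>) x v w) 1 2 y"
    using teardrop_chart.exterior_deriv_primitive[OF \<tau>(3), of y] gauss_curvature_stereo[OF \<tau>(2)]
    by (simp add: \<tau>(1) pullback2_def)
qed

end

text \<open>Projection from the north pole gives the chart centred at the south pole, so small
  \<open>s\<close> means close to the tip. It is also the chart that \<open>form_integral\<close>
  uses.\<close>

sublocale teardrop_param \<subseteq> north: teardrop_chart \<delta> "-1"
  by (rule chart) simp

context teardrop_param
begin

text \<open>The conformal factor has the antiderivative
  \<open>4 / (1 - \<delta>) * sqrt (W s)\<close>, and \<open>sqrt (W s)\<close> runs from \<delta>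
  at the tip to 1 at infinity. The normalization \<open>(1 + \<delta>) / 2\<close> of the metric is
  fixed by this computation.\<close>

lemma total_area_teardrop: "total_area (teardrop \<delta>) = 4 * pi"
proof -
  let ?F = "\<lambda>s. 4 / (1 - \<delta>) * sqrt (north.W s)"
  have W: "north.W = (\<lambda>s. (\<delta>\<^sup>2 + s) / (1 + s))"
    by (simp add: north.W_def north.p_def north.q_def fun_eq_iff)
  have "((\<lambda>s. north.W s) \<longlongrightarrow> 1) at_top"
  proof (rule Lim_transform_eventually)
    have "filterlim (\<lambda>s::real. 1 + s) at_infinity at_top"
      by (rule filterlim_at_top_imp_at_infinity[OF
            filterlim_tendsto_add_at_top[OF tendsto_const filterlim_ident]])
    then have "((\<lambda>s. 1 - (1 - \<delta>\<^sup>2) / (1 + s)) \<longlongrightarrow> 1 - 0) at_top"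
      by (intro tendsto_diff tendsto_const tendsto_divide_0[OF tendsto_const])
    then show "((\<lambda>s. 1 - (1 - \<delta>\<^sup>2) / (1 + s)) \<longlongrightarrow> 1) at_top" by simp
    show "\<forall>\<^sub>F s in at_top. 1 - (1 - \<delta>\<^sup>2) / (1 + s) = north.W s"
      using eventually_ge_at_top[of 0]
      by eventually_elim (simp add: W divide_simps)
  qed
  then have lim: "(?F \<longlongrightarrow> 4 / (1 - \<delta>) * sqrt 1) at_top"
    by (intro tendsto_intros)
  have "(LINT y|lborel. north.\<rho> ((norm (y::real^2))\<^sup>2)) = pi * (4 / (1 - \<delta>) * sqrt 1 - ?F 0)"
  proof (rule radial_integral[OF _ _ _ lim])
    show "north.\<rho> \<in> borel_measurable borel"
      unfolding north.\<rho>_def[abs_def] north.W_def by measurable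
    fix s :: real assume s: "s \<ge> 0"
    show "0 \<le> north.\<rho> s" using north.\<rho>_pos[OF s] by simp
    have "(?F has_real_derivative 4 / (1 - \<delta>) *
        (- (north.p - north.q) / (2 * sqrt (north.W s) * (1 + s)\<^sup>2))) (at s)"
      by (intro DERIV_cmult north.sqrt_W_deriv s)
    also have "4 / (1 - \<delta>) * (- (north.p - north.q) / (2 * sqrt (north.W s) * (1 + s)\<^sup>2)) = north.\<rho> s"
    proof -
      have "- (north.p - north.q) = (1 - \<delta>) * (1 + \<delta>)"
        unfolding north.pq(3) by (simp add: power2_eq_square algebra_simps)
      then show ?thesis
        using \<delta>_less_1 unfolding north.\<rho>_def by (simp add: divide_simps)
    qed
    finally show "(?F has_real_derivative north.\<rho> s) (at s)" .
  qed
  also have "4 / (1 - \<delta>) * sqrt 1 - ?F 0 = 4"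
  proof -
    have "sqrt (north.W 0) = \<delta>" using \<delta>_pos by (simp add: W)
    then have "4 / (1 - \<delta>) * sqrt 1 - ?F 0 = 4 / (1 - \<delta>) * (1 - \<delta>)"
      by (simp only: right_diff_distrib real_sqrt_one)
    also have "\<dots> = 4"
      using nonzero_mult_div_cancel_right[of "1 - \<delta>" 4] \<delta>_less_1
      by (simp only: times_divide_eq_left)
    finally show ?thesis .
  qed
  finally show ?thesis
    by (simp add: total_area_def form_integral_def stereo_N_eq north.pullback2_area_form)
qed

subsection \<open>The norm of a primitive\<close>

text \<open>The dual norm inequality follows by testing the supremum on \<open>v\<close> divided by
  its length. As the supremum is a real one, boundedness on the unit ball comes first: the metric at
  \<open>x\<close> is a positive multiple of the Euclidean product, and \<alpha> has finite operator
  norm.\<close>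

lemma covector_le:
  assumes x: "x \<in> S2" and lin: "linear \<alpha>" and v: "v \<in> tangent_space x"
  shows "\<bar>\<alpha> v\<bar> \<le> covector_norm (teardrop \<delta>) x \<alpha> * sqrt (teardrop \<delta> x v v)"
proof (cases "v = 0")
  case True
  then show ?thesis using linear_0[OF lin] by (simp add: teardrop_def)
next
  case False
  define f where "f = (1 + \<delta>) / (2 * sqrt (weight \<delta> x))"
  have f: "f > 0" using weight_bounds(1)[OF x] \<delta>_pos by (simp add: f_def)
  have g: "teardrop \<delta> x u u = f * (norm u)\<^sup>2" for u
    by (simp add: teardrop_def f_def power2_norm_eq_inner)
  define r where "r = sqrt (teardrop \<delta> x v v)"
  have r: "r > 0" "r\<^sup>2 = f * (norm v)\<^sup>2" using f False by (simp_all add: r_def g)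
  have "\<bar>\<alpha> ((1 / r) *\<^sub>R v)\<bar> \<le> covector_norm (teardrop \<delta>) x \<alpha>"
    unfolding covector_norm_def
  proof (rule cSUP_upper)
    show "(1 / r) *\<^sub>R v \<in> {v \<in> tangent_space x. teardrop \<delta> x v v \<le> 1}"
      using v r by (auto simp: tangent_space_def g power_mult_distrib power_divide)
    show "bdd_above ((\<lambda>v. \<bar>\<alpha> v\<bar>) ` {v \<in> tangent_space x. teardrop \<delta> x v v \<le> 1})"
    proof (rule bdd_aboveI2)
      fix u assume "u \<in> {v \<in> tangent_space x. teardrop \<delta> x v v \<le> 1}"
      then have "(norm u)\<^sup>2 \<le> 1 / f" using f by (simp add: g field_simps)
      then have "norm u \<le> sqrt (1 / f)" by (simp add: real_le_rsqrt)
      moreover have "\<bar>\<alpha> u\<bar> \<le> onorm \<alpha> * norm u"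
        using onorm[OF linear_conv_bounded_linear[THEN iffD1, OF lin], of u] by simp
      ultimately show "\<bar>\<alpha> u\<bar> \<le> onorm \<alpha> * sqrt (1 / f)"
        by (meson mult_left_mono onorm_pos_le linear_conv_bounded_linear lin order_trans)
    qed
  qed
  moreover have "\<alpha> ((1 / r) *\<^sub>R v) = \<alpha> v / r"
    using linear_scale[OF lin, of "1 / r" v] by simp
  ultimately show ?thesis using r(1) by (simp add: r_def[symmetric] field_simps)
qed

text \<open>Without a bound the real supremum over the sphere would not dominate its terms. The unit
  discs of the two charts cover the sphere; on these compact sets the coefficients are bounded, and
  the coordinate frame is comparable to an orthonormal one.\<close>

lemma bdd_above_covector_norm:
  assumes \<beta>: "one_form \<beta>"
  shows "bdd_above ((\<lambda>x. covector_norm (teardrop \<delta>) x (\<beta> x)) ` S2)"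
proof -
  have "\<exists>B. \<forall>y\<in>cball 0 1. \<bar>pullback1 (stereo \<tau>) \<beta> i y\<bar> \<le> B" if \<tau>: "\<tau> = 1 \<or> \<tau> = -1" for \<tau> i
  proof -
    have "stereo \<tau> \<in> atlas" using \<tau> by (auto simp: atlas_def stereo_N_eq stereo_S_eq)
    then have "smooth (pullback1 (stereo \<tau>) \<beta> i)" using \<beta> by (simp add: one_form_def)
    then have "compact (pullback1 (stereo \<tau>) \<beta> i ` cball 0 1)"
      by (intro compact_continuous_image smooth_continuous) auto
    then show ?thesis
      using bounded_iff[THEN iffD1, OF compact_imp_bounded] by fastforce
  qed
  then obtain B where B: "\<And>\<tau> i y. \<tau> = 1 \<or> \<tau> = -1 \<Longrightarrow> y \<in> cball 0 1 \<Longrightarrow>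
      \<bar>pullback1 (stereo \<tau>) \<beta> i y\<bar> \<le> B \<tau> i" by metis
  define M where "M = \<bar>B 1 1\<bar> + \<bar>B 1 2\<bar> + \<bar>B (-1) 1\<bar> + \<bar>B (-1) 2\<bar>"
  have M: "\<bar>pullback1 (stereo \<tau>) \<beta> i y\<bar> \<le> M" if "\<tau> = 1 \<or> \<tau> = -1" "y \<in> cball 0 1" for \<tau> i y
    using B[OF that, of i] that(1) exhaust_2[of i] by (auto simp: M_def)
  show ?thesis
  proof (rule bdd_aboveI2)
    fix x assume x: "x \<in> S2"
    \<comment> \<open>The chart centred in the hemisphere of \<open>x\<close> puts its coordinates
      into the closed unit disc.\<close>
    obtain \<tau> :: real where \<tau>: "\<tau> = 1 \<or> \<tau> = -1" and z: "\<tau> * x$3 \<ge> 0"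
    proof (cases "x $ 3 \<ge> 0")
      case True then show thesis using that[of 1] by simp
    next
      case False then show thesis using that[of "-1"] by simp
    qed
    obtain y where y: "stereo \<tau> y = x" "1 + (norm y)\<^sup>2 = 2 / (1 + \<tau> * x$3)"
      using stereo_surj[OF \<tau> x] z by (metis add_nonneg_eq_0_iff zero_le_one zero_neq_one)
    define D where "D = 1 + (norm y)\<^sup>2"
    have D1: "1 \<le> D" by (simp add: D_def)
    have D2: "D \<le> 2" unfolding D_def y(2) using z by (simp add: divide_simps)
    note D = D1 D2
    then have yball: "y \<in> cball 0 1" by (simp add: D_def abs_square_le_1)
    have lin: "linear (\<beta> x)" using \<beta> x by (simp add: one_form_def)
    show "covector_norm (teardrop \<delta>) x (\<beta> x) \<le> 4 * M"
      unfolding covector_norm_def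
    proof (rule cSUP_least)
      show "{v \<in> tangent_space x. teardrop \<delta> x v v \<le> 1} \<noteq> {}"
        by (auto simp: tangent_space_def teardrop_def intro!: exI[of _ 0])
      fix v assume v: "v \<in> {v \<in> tangent_space x. teardrop \<delta> x v v \<le> 1}"
      let ?e = "\<lambda>i. partial_deriv i (stereo \<tau>) y"
      let ?c = "\<lambda>i. D\<^sup>2 / 4 * (v \<bullet> ?e i)"
      have "v \<bullet> x = 0" using v by (simp add: tangent_space_def inner_commute)
      then have "v = ?c 1 *\<^sub>R ?e 1 + ?c 2 *\<^sub>R ?e 2"
        using stereo_geometry(5)[OF \<tau>, of v y, unfolded y(1), folded D_def] by simp
      then have "\<beta> x v = \<beta> x (?c 1 *\<^sub>R ?e 1 + ?c 2 *\<^sub>R ?e 2)" by simp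
      then have \<beta>v: "\<beta> x v = ?c 1 * pullback1 (stereo \<tau>) \<beta> 1 y + ?c 2 * pullback1 (stereo \<tau>) \<beta> 2 y"
        by (simp only: linear_add[OF lin] linear_scale[OF lin] pullback1_def y(1) real_scaleR_def)
      \<comment> \<open>As the weight is at most 1, the conformal factor is at least 1/2, so g-unit
        vectors have bounded Euclidean length.\<close>
      have "(norm v)\<^sup>2 \<le> 4"
      proof -
        have "sqrt (weight \<delta> x) > 0" "sqrt (weight \<delta> x) \<le> 1"
          using weight_bounds[OF x] by simp_all
        then have "1 \<le> (1 + \<delta>) / sqrt (weight \<delta> x)"
          using \<delta>_pos by (subst pos_le_divide_eq) linarith+
        then have "(norm v)\<^sup>2 / 2 \<le> (1 + \<delta>) / sqrt (weight \<delta> x) * ((norm v)\<^sup>2 / 2)"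
          using mult_right_mono[of 1 "(1 + \<delta>) / sqrt (weight \<delta> x)" "(norm v)\<^sup>2 / 2"]
          by (simp only: mult_1) simp
        also have "\<dots> \<le> 1" using v by (simp add: teardrop_def power2_norm_eq_inner)
        finally show ?thesis by simp
      qed
      then have nv: "norm v \<le> 2" using power2_le_imp_le[of "norm v" 2] by simp
      have c: "\<bar>?c i\<bar> \<le> 2" for i
      proof -
        have "(norm (?e i))\<^sup>2 = (2 / D)\<^sup>2"
          using stereo_geometry(3)[OF \<tau>, of i y i] by (simp add: power2_norm_eq_inner D_def power_divide)
        then have "norm (?e i) = 2 / D" using D by (simp add: power2_eq_iff_nonneg)
        then have "\<bar>v \<bullet> ?e i\<bar> \<le> norm v * (2 / D)"
          using Cauchy_Schwarz_ineq2[of v "?e i"] by simp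
        then have "\<bar>?c i\<bar> \<le> D\<^sup>2 / 4 * (norm v * (2 / D))"
          unfolding abs_mult by (intro mult_mono) auto
        also have "\<dots> = D * norm v / 2" using D by (simp add: power2_eq_square)
        also have "\<dots> \<le> 2" using D nv mult_mono[of D 2 "norm v" 2] by simp
        finally show ?thesis .
      qed
      have "\<bar>?c i * pullback1 (stereo \<tau>) \<beta> i y\<bar> \<le> 2 * M" for i
        unfolding abs_mult[of "?c i"] using c[of i] M[OF \<tau> yball, of i]
        by (intro mult_mono) auto
      from this[of 1] this[of 2] show "\<bar>\<beta> x v\<bar> \<le> 4 * M"
        unfolding \<beta>v by linarith
    qed
  qed
qed

text \<open>By Stokes every primitive has the same integral over the circle of radius \<open>\<delta>\<close> as the explicit
  one; on that circle \<open>|\<beta>|\<close> bounds the integrand by the metric length of the velocity.\<close>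

lemma covector_norm_circle:
  assumes \<beta>: "one_form \<beta>"
    and d\<beta>: "has_exterior_deriv \<beta>
      (\<lambda>x v w. (1 - gauss_curvature (teardrop \<delta>) x) * area_form (teardrop \<delta>) x v w)"
    and M: "\<And>x. x \<in> S2 \<Longrightarrow> covector_norm (teardrop \<delta>) x (\<beta> x) \<le> M"
  shows "r\<^sup>2 * \<bar>north.b (r\<^sup>2)\<bar> \<le> M * sqrt (r\<^sup>2 * north.\<rho> (r\<^sup>2))"
proof -
  let ?P = "\<lambda>i. pullback1 (stereo (-1)) \<beta> i" and ?Q = "\<lambda>i. pullback1 (stereo (-1)) (primitive \<delta>) i"
  define c :: "real \<Rightarrow> real^2" where "c t = vector [r * cos t, r * sin t]" for t
  let ?A = "\<lambda>t. r * (?P 2 (c t) * cos t - ?P 1 (c t) * sin t)"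
  have atlas: "stereo (-1) \<in> atlas" by (simp add: atlas_def stereo_N_eq)
  have sP: "smooth (?P i)" and sQ: "smooth (?Q i)" for i
    using \<beta> one_form_primitive atlas by (auto simp: one_form_def)
  \<comment> \<open>The difference of two primitives of the same form is closed.\<close>
  have I0: "integral {0..2*pi} (\<lambda>t. r * ((?P 2 (c t) - ?Q 2 (c t)) * cos t - (?P 1 (c t) - ?Q 1 (c t)) * sin t)) = 0"
    unfolding c_def
  proof (rule closed_form_circle_integral)
    show "smooth (\<lambda>y. ?P 1 y - ?Q 1 y)" "smooth (\<lambda>y. ?P 2 y - ?Q 2 y)"
      by (intro smooth_diff sP sQ)+
    fix y
    have "partial_deriv 1 (?P 2) y - partial_deriv 2 (?P 1) y = partial_deriv 1 (?Q 2) y - partial_deriv 2 (?Q 1) y"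
      using d\<beta> has_exterior_deriv_primitive atlas by (simp add: has_exterior_deriv_def)
    then show "partial_deriv 1 (\<lambda>y. ?P 2 y - ?Q 2 y) y = partial_deriv 2 (\<lambda>y. ?P 1 y - ?Q 1 y) y"
      by (simp add: smooth_partial_deriv_diff sP sQ)
  qed
  have nc: "(norm (c t))\<^sup>2 = r\<^sup>2" for t
    by (simp add: c_def norm_sq_2 vector_2 power_mult_distrib distrib_left[symmetric])
  \<comment> \<open>By rotational symmetry the explicit primitive contributes a constant integrand
    along the circle.\<close>
  have A: "r * ((?P 2 (c t) - ?Q 2 (c t)) * cos t - (?P 1 (c t) - ?Q 1 (c t)) * sin t)
      = ?A t - r\<^sup>2 * north.b (r\<^sup>2)" for t
  proof -
    have "?Q 1 (c t) = - (r * sin t * north.b (r\<^sup>2))" "?Q 2 (c t) = r * cos t * north.b (r\<^sup>2)"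
      unfolding north.pullback1_primitive nc by (simp_all add: c_def vector_2)
    then show ?thesis using sin_cos_squared_add[of t] by algebra
  qed
  have zero: "integral {0..2*pi} (\<lambda>t. ?A t - r\<^sup>2 * north.b (r\<^sup>2)) = 0"
    using I0 unfolding A .
  have contc: "continuous_on S c" for S
  proof -
    have "c = (\<lambda>t. (r * cos t) *\<^sub>R axis 1 1 + (r * sin t) *\<^sub>R axis 2 1)"
      by (simp add: c_def fun_eq_iff vec_eq_iff forall_2 axis_def)
    then show ?thesis by (simp add: continuous_intros)
  qed
  have "continuous_on {0..2*pi} (\<lambda>t. ?P i (c t))" for i
    by (rule continuous_on_compose2[OF smooth_continuous[OF sP, of UNIV] contc]) simp
  then have contA: "continuous_on {0..2*pi} ?A"
    by (intro continuous_intros)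
  then have int: "?A integrable_on {0..2*pi}"
    by (rule integrable_continuous_real)
  have eq: "integral {0..2*pi} ?A = 2 * pi * (r\<^sup>2 * north.b (r\<^sup>2))"
    using zero by (subst (asm) integral_diff[OF int]) auto
  have bound: "norm (?A t) \<le> M * sqrt (r\<^sup>2 * north.\<rho> (r\<^sup>2))" for t
  proof -
    let ?x = "stereo (-1) (c t)" and ?e = "\<lambda>i. partial_deriv i (stereo (-1)) (c t)"
    \<comment> \<open>The velocity of the image circle on the sphere.\<close>
    define v where "v = (- r * sin t) *\<^sub>R ?e 1 + (r * cos t) *\<^sub>R ?e 2"
    have x: "?x \<in> S2" by (simp add: stereo_in_S2)
    have lin: "linear (\<beta> ?x)" using \<beta> x by (simp add: one_form_def)
    have A: "?A t = \<beta> ?x v"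
      unfolding v_def linear_add[OF lin] linear_scale[OF lin]
      by (simp add: pullback1_def algebra_simps)
    have e: "teardrop \<delta> ?x (?e i) (?e j) = (if i = j then north.\<rho> (r\<^sup>2) else 0)" for i j
      using north.pullback2_teardrop[of i j "c t"] by (simp add: pullback2_def nc)
    have g: "teardrop \<delta> ?x v v = r\<^sup>2 * north.\<rho> (r\<^sup>2)"
    proof -
      have "teardrop \<delta> ?x v v = (r * sin t)\<^sup>2 * teardrop \<delta> ?x (?e 1) (?e 1)
          + (r * cos t)\<^sup>2 * teardrop \<delta> ?x (?e 2) (?e 2)
          - 2 * (r * sin t) * (r * cos t) * teardrop \<delta> ?x (?e 1) (?e 2)"
        unfolding teardrop_def v_def
        by (simp only: inner_add_left inner_add_right inner_scaleR_left inner_scaleR_right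
            inner_commute[of "?e 2" "?e 1"]) algebra
      also have "\<dots> = r\<^sup>2 * north.\<rho> (r\<^sup>2) * ((sin t)\<^sup>2 + (cos t)\<^sup>2)"
        by (simp only: e if_True if_False) (simp, use sin_cos_squared_add[of t] in algebra)
      finally show ?thesis by simp
    qed
    have "v \<in> tangent_space ?x"
      by (simp add: tangent_space_def v_def inner_add_right inner_diff_right stereo_geometry(2))
    from covector_le[OF x lin this] have "\<bar>?A t\<bar> \<le> covector_norm (teardrop \<delta>) ?x (\<beta> ?x) * sqrt (r\<^sup>2 * north.\<rho> (r\<^sup>2))"
      unfolding A g .
    also have "\<dots> \<le> M * sqrt (r\<^sup>2 * north.\<rho> (r\<^sup>2))"
      using M[OF x] north.\<rho>_pos[of "r\<^sup>2"] by (intro mult_right_mono) auto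
    finally show ?thesis by simp
  qed
  have "norm (integral {0..2*pi} ?A) \<le> (M * sqrt (r\<^sup>2 * north.\<rho> (r\<^sup>2))) * (2 * pi - 0)"
    by (rule integral_bound[OF _ contA]) (use bound in simp_all)
  then have "2 * pi * (r\<^sup>2 * \<bar>north.b (r\<^sup>2)\<bar>) \<le> 2 * pi * (M * sqrt (r\<^sup>2 * north.\<rho> (r\<^sup>2)))"
    unfolding eq by (simp add: abs_mult algebra_simps)
  then show ?thesis
    using mult_le_cancel_left_pos[of "2 * pi"] by simp
qed

text \<open>The circle of radius \<delta> in the chart lies where the tip is rounded: there the
  weight is about \<open>2 \<delta>\<^sup>2\<close>. Dividing by \<open>2 pi\<close>, the flux is at
  least 1/10 in absolute value and the length at most \<open>2 * sqrt \<delta>\<close>; their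
  quotient is the bound.\<close>

lemma primitive_norm_ge:
  assumes small: "\<delta> \<le> 1 / 1024"
    and \<beta>: "one_form \<beta>"
    and d\<beta>: "has_exterior_deriv \<beta>
      (\<lambda>x v w. (1 - gauss_curvature (teardrop \<delta>) x) * area_form (teardrop \<delta>) x v w)"
  shows "(SUP x\<in>S2. covector_norm (teardrop \<delta>) x (\<beta> x)) \<ge> 1 / (20 * sqrt \<delta>)"
proof -
  define M where "M = (SUP x\<in>S2. covector_norm (teardrop \<delta>) x (\<beta> x))"
  \<comment> \<open>\<open>r\<close> is the square root of the weight on this circle, the argument
    at which \<open>b\<close> evaluates \<open>profile\<close>.\<close>
  define r where "r = sqrt (2 * \<delta>\<^sup>2 / (1 + \<delta>\<^sup>2))"
  have W: "north.W (\<delta>\<^sup>2) = 2 * \<delta>\<^sup>2 / (1 + \<delta>\<^sup>2)"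
    by (simp add: north.W_def north.p_def north.q_def)
  have \<delta>2: "0 < \<delta>\<^sup>2" "\<delta>\<^sup>2 \<le> 1 / 1024"
    using \<delta>_pos small mult_mono[of \<delta> "1/1024" \<delta> 1] by (auto simp: power2_eq_square)
  have r2: "r\<^sup>2 = 2 * \<delta>\<^sup>2 / (1 + \<delta>\<^sup>2)"
    using \<delta>2 by (simp add: r_def)
  have "\<delta>\<^sup>2 \<le> r\<^sup>2"
    unfolding r2 using \<delta>2 mult_left_mono[of "\<delta>\<^sup>2" 1 "\<delta>\<^sup>2"]
    by (subst pos_le_divide_eq) (auto simp: distrib_left intro: add_pos_nonneg)
  then have r\<delta>: "\<delta> \<le> r"
    by (rule power2_le_imp_le) (use \<delta>2 in \<open>simp add: r_def\<close>)
  have r0: "r > 0" using r\<delta> \<delta>_pos by simp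
  have "\<delta>\<^sup>2 * \<bar>north.b (\<delta>\<^sup>2)\<bar> \<le> M * sqrt (\<delta>\<^sup>2 * north.\<rho> (\<delta>\<^sup>2))"
  proof (rule covector_norm_circle[OF \<beta> d\<beta>])
    show "covector_norm (teardrop \<delta>) x (\<beta> x) \<le> M" if "x \<in> S2" for x
      unfolding M_def by (rule cSUP_upper[OF that bdd_above_covector_norm[OF \<beta>]])
  qed
  moreover have "1 / 10 \<le> \<delta>\<^sup>2 * \<bar>north.b (\<delta>\<^sup>2)\<bar>"
  proof -
    have "\<delta>\<^sup>2 * profile \<delta> r = 2 * \<delta>\<^sup>2 / ((1 + r) * (r + \<delta>)) - (1 + \<delta>\<^sup>2) / 4"
      unfolding profile_def r2 using \<delta>_pos by (simp add: right_diff_distrib divide_simps)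
    \<comment> \<open>Only the term \<open>1 / (2 * r\<^sup>2)\<close> of \<open>profile\<close>
      survives as \<delta> tends to 0; it stems from the curvature and contributes about -1/4. The
      other term is at most \<open>2 * \<delta>\<close>.\<close>
    also have "\<dots> \<le> 2 * \<delta> - (1 + \<delta>\<^sup>2) / 4"
    proof -
      have "2 * \<delta>\<^sup>2 / ((1 + r) * (r + \<delta>)) \<le> 2 * \<delta>\<^sup>2 / (1 * \<delta>)"
        using r0 \<delta>_pos by (intro divide_left_mono mult_mono) auto
      then show ?thesis using \<delta>_pos by (simp add: power2_eq_square)
    qed
    also have "\<dots> \<le> - 1 / 5" using small \<delta>2 by argo
    finally have Q: "1 / 5 \<le> - (\<delta>\<^sup>2 * profile \<delta> r)" by simp
    have F: "1 / 2 \<le> (1 - \<delta>\<^sup>2) / (1 + \<delta>\<^sup>2)\<^sup>2"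
    proof -
      have "(1 + \<delta>\<^sup>2)\<^sup>2 \<le> (1 + 1 / 1024)\<^sup>2" using \<delta>2 by (intro power_mono) auto
      then have le: "(1 + \<delta>\<^sup>2)\<^sup>2 \<le> 3 / 2" by (simp add: power2_eq_square)
      have pos: "0 < (1 + \<delta>\<^sup>2)\<^sup>2" by (rule zero_less_power[OF add_pos_pos[OF zero_less_one \<delta>2(1)]])
      show ?thesis unfolding pos_le_divide_eq[OF pos] using le \<delta>2 by linarith
    qed
    have "1 / 10 \<le> (1 - \<delta>\<^sup>2) / (1 + \<delta>\<^sup>2)\<^sup>2 * - (\<delta>\<^sup>2 * profile \<delta> r)"
      using mult_mono[OF F Q] F by simp
    also have "\<dots> = - (\<delta>\<^sup>2 * north.b (\<delta>\<^sup>2))"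
      by (simp add: north.b_def W r_def)
    also have "\<dots> \<le> \<delta>\<^sup>2 * \<bar>north.b (\<delta>\<^sup>2)\<bar>"
      unfolding mult_minus_right[symmetric] by (intro mult_left_mono) auto
    finally show ?thesis .
  qed
  ultimately have le: "1 / 10 \<le> M * sqrt (\<delta>\<^sup>2 * north.\<rho> (\<delta>\<^sup>2))" by simp
  \<comment> \<open>The length of the circle divided by \<open>2 pi\<close>: the conformal factor
    there is of order \<open>1 / \<delta>\<close>, against a squared radius of
    \<open>\<delta>\<^sup>2\<close>.\<close>
  have root: "sqrt (\<delta>\<^sup>2 * north.\<rho> (\<delta>\<^sup>2)) \<le> 2 * sqrt \<delta>"
  proof -
    have "\<delta>\<^sup>2 * north.\<rho> (\<delta>\<^sup>2) = 2 * (1 + \<delta>) * \<delta>\<^sup>2 / (r * (1 + \<delta>\<^sup>2)\<^sup>2)"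
      by (simp add: north.\<rho>_def W r_def)
    also have "\<dots> \<le> 2 * 2 * \<delta>\<^sup>2 / (\<delta> * 1)"
      using r\<delta> \<delta>_pos \<delta>_less_1 by (intro frac_le mult_mono one_le_power) auto
    also have "\<dots> = 4 * \<delta>" using \<delta>_pos by (simp add: power2_eq_square)
    finally have "sqrt (\<delta>\<^sup>2 * north.\<rho> (\<delta>\<^sup>2)) \<le> sqrt (4 * \<delta>)" by simp
    then show ?thesis by (simp add: real_sqrt_mult)
  qed
  have pos: "sqrt (\<delta>\<^sup>2 * north.\<rho> (\<delta>\<^sup>2)) > 0"
    using \<delta>_pos north.\<rho>_pos[of "\<delta>\<^sup>2"] by simp
  \<comment> \<open>The sign of \<open>M\<close> is what permits replacing the length by its upper
    bound.\<close>
  have "M > 0"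
  proof (rule ccontr)
    assume "\<not> M > 0"
    then have "M * sqrt (\<delta>\<^sup>2 * north.\<rho> (\<delta>\<^sup>2)) \<le> 0" using pos by (intro mult_nonpos_nonneg) auto
    then show False using le by simp
  qed
  then have "M * sqrt (\<delta>\<^sup>2 * north.\<rho> (\<delta>\<^sup>2)) \<le> M * (2 * sqrt \<delta>)"
    using root by (intro mult_left_mono) auto
  then have "1 / 10 \<le> M * (2 * sqrt \<delta>)" using le by simp
  then show ?thesis
    unfolding M_def[symmetric] using \<delta>_pos by (simp add: divide_simps mult_ac)
qed

text \<open>A lower bound on a real infimum requires a nonempty set. The explicit primitive provides
  a member directly, in place of an appeal to Gauss-Bonnet.\<close>

lemma min_primitive_norm_ge:
  assumes "\<delta> \<le> 1 / 1024"
  shows "min_primitive_norm (teardrop \<delta>) (area_form (teardrop \<delta>)) \<ge> 1 / (20 * sqrt \<delta>)"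
  unfolding min_primitive_norm_def
proof (rule cINF_greatest)
  show "{\<beta>. one_form \<beta> \<and> has_exterior_deriv \<beta>
      (\<lambda>x v w. (1 - gauss_curvature (teardrop \<delta>) x) * area_form (teardrop \<delta>) x v w)} \<noteq> {}"
    using one_form_primitive has_exterior_deriv_primitive by blast
qed (use primitive_norm_ge[OF assms] in blast)

end

theorem proposition1p1:
  shows "\<forall>C::real. C > 0 \<longrightarrow> (\<exists>g. riemannian_metric g \<and>
    (\<forall>x\<in>S2. gauss_curvature g x \<ge> 0) \<and>
    total_area g = 4 * pi \<and>
    min_primitive_norm g (area_form g) > C)"
proof (intro allI impI)
  fix C :: real assume C: "C > 0"
  \<comment> \<open>With this choice \<open>1 / (20 * sqrt \<delta>)\<close> equals
    \<open>8/5 * (C + 1)\<close>, which exceeds \<open>C\<close>, and the factor 32 secures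
    \<open>\<delta> \<le> 1 / 1024\<close>.\<close>
  define \<delta> where "\<delta> = (1 / (32 * (C + 1)))\<^sup>2"
  have \<delta>: "0 < \<delta>" "\<delta> \<le> 1 / 1024"
  proof -
    show "0 < \<delta>" using C by (simp add: \<delta>_def)
    have "1 / (32 * (C + 1)) \<le> 1 / 32" using C by (simp add: divide_simps)
    then have "\<delta> \<le> (1 / 32)\<^sup>2" unfolding \<delta>_def using C by (intro power_mono) auto
    then show "\<delta> \<le> 1 / 1024" by (simp add: power2_eq_square)
  qed
  interpret teardrop_param \<delta> by unfold_locales (use \<delta> in auto)
  have "sqrt \<delta> = 1 / (32 * (C + 1))" using C by (simp add: \<delta>_def)
  then have "C < 1 / (20 * sqrt \<delta>)" using C by simp
  then have "C < min_primitive_norm (teardrop \<delta>) (area_form (teardrop \<delta>))"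
    using min_primitive_norm_ge[OF \<delta>(2)] by simp
  then show "\<exists>g. riemannian_metric g \<and> (\<forall>x\<in>S2. gauss_curvature g x \<ge> 0) \<and>
      total_area g = 4 * pi \<and> min_primitive_norm g (area_form g) > C"
    using riemannian_metric_teardrop gauss_curvature_nonneg total_area_teardrop by blast
qed

end
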